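(* Let $G$ be a compact connected Hausdorff topological group, $X$ a Hausdorff topological space, $k\in\mathbb N$, and $p:X\to G$ a $k$-fold covering mapping. Let $\{G_\lambda,\pi_\lambda^\mu,\Lambda\}$ be an inverse system of compact groups with $(G,\{\pi_\lambda\})=\varprojlim\{G_\lambda,\pi_\lambda^\mu,\Lambda\}$, as in the context, and let the index $\alpha\in\Lambda$, the spaces $X_\lambda$ and the mappings $p_\lambda:X_\lambda\to G_\lambda$, $h_\lambda:X\to X_\lambda$ ($\lambda\in\Lambda_\alpha$) and $h_\lambda^\mu:X_\mu\to X_\lambda$ be those constructed in the context. Then there is an index $\beta\in\Lambda_\alpha$ such that $p_\lambda$ is a $k$-fold covering mapping for each $\lambda\in\Lambda_\beta$, and the covering mapping $p:X\to G$ is up to isomorphism the limit morphism induced by the morphism $$\{p_\lambda:\lambda\in\Lambda_\beta\}:\{X_\lambda,h_\lambda^\mu,\Lambda_\beta\}\longrightarrow\{G_\lambda,\pi_\lambda^\mu,\Lambda_\beta\}$$ of inverse systems in the category of compact Hausdorff spaces and continuous mappings.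
   Context: Conventions. All spaces are Hausdorff, mappings are continuous, $\mathbb N=\{1,2,\dots\}$, $\overline m=\{1,\dots,m\}$. A continuous surjection $p:X\to Y$ is a $k$-fold covering mapping if every $y\in Y$ has an open neighborhood $W$ (called evenly covered) such that $p^{-1}(W)$ is a disjoint union of $k$ open sets (slices), each mapped homeomorphically onto $W$ by $p$. Inverse systems. For a directed set $(\Lambda,\prec)$ and $\nu\in\Lambda$ put $\Lambda_\nu=\{\lambda\in\Lambda:\nu\prec\lambda\}$. An inverse system $\{Y_\lambda,\sigma_\lambda^\mu,\Lambda\}$ has bonding morphisms $\sigma_\lambda^\mu:Y_\mu\to Y_\lambda$ for $\lambda\prec\mu$ with $\sigma_\lambda^\lambda=\mathrm{id}$ and $\sigma_\lambda^\nu=\sigma_\lambda^\mu\circ\sigma_\mu^\nu$ for $\lambda\prec\mu\prec\nu$; $Y_\infty$ denotes its inverse limit realized as the space of threads. A morphism $\{X_\lambda,\pi_\lambda^\mu,\Lambda\}\to\{Y_\lambda,\sigma_\lambda^\mu,\Lambda\}$ is a family $\tau_\lambda:X_\lambda\to Y_\lambda$ with $\tau_\lambda\circ\pi_\lambda^\mu=\sigma_\lambda^\mu\circ\tau_\mu$ for $\lambda\prec\mu$; its induced limit morphism is $\tau_\infty:X_\infty\to Y_\infty$, $\tau_\infty(\{x_\lambda\})=\{\tau_\lambda(x_\lambda)\}$. A morphism $\tau:X\to Y$ is up to isomorphism the limit morphism induced by $\{\tau_\lambda\}$ if there are isomorphisms (here homeomorphisms) $\rho:X\to X_\infty$ and $\sigma:Y\to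 Y_\infty$ with $\tau_\infty\circ\rho=\sigma\circ\tau$. Setting. $(G,\{\pi_\lambda\})=\varprojlim\{G_\lambda,\pi_\lambda^\mu,\Lambda\}$ in the category of compact groups and continuous homomorphisms, where all $G_\lambda$ are connected (compact) Lie groups, all $\pi_\lambda^\mu$ and all projections $\pi_\lambda:G\to G_\lambda$ are open and surjective, and every $G_\lambda$ is abelian if $G$ is abelian. (In the conclusion the group structures are forgotten.) Construction. Fix $\alpha\in\Lambda$, $m\in\mathbb N$ and finite open covers $\{W_n:n\in\overline m\}$ of $G$ and $\{W_n^\alpha:n\in\overline m\}$ of $G_\alpha$ with $W_n=\pi_\alpha^{-1}(W_n^\alpha)$ and every $W_n$ evenly covered by $p$ (such data exist). For each $n\in\overline m$ fix an indexed partition $p^{-1}(W_n)=\bigsqcup_{l=1}^k V_l^n$ into slices. Fix a finite open cover $\{U_n^\alpha:n\in\overline m\}$ of $G_\alpha$ with $U_n^\alpha\subset W_n^\alpha$ and such that $U_n:=\pi_\alpha^{-1}(U_n^\alpha)$ satisfies $\overline{U_n}\subset W_n$ for each $n$. Fix a continuous partition of unity $\phi_n:G_\alpha\to[0,1]$, $n\in\overline m$, with the closure of $\phi_n^{-1}((0,1])$ contained in $U_n^\alpha$ and $\sum_{n=1}^m\phi_n=1$. Put $\widehat\psi_n=\phi_n\circ\pi_\alpha\circ p:X\to[0,1]$. Define $f_n:X\to\mathbb C$ by $f_n(x)=0$ if $x\notin p^{-1}(W_n)$ and $f_n(x)=\exp\bigl(i\tfrac{2\pi}{k}(l-1)\bigr)$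 if $x\in V_l^n$, and put $\widehat f_n=\widehat\psi_n f_n$ (a continuous function). For $\lambda\in\Lambda_\alpha$ let $$h_\lambda(x)=\bigl(\pi_\lambda(p(x)),\widehat f_1(x),\dots,\widehat f_m(x)\bigr)\in G_\lambda\times\mathbb C^m,\quad x\in X,$$ let $X_\lambda=h_\lambda(X)\subset G_\lambda\times\mathbb C^m$ with the subspace topology (a compact space), regard $h_\lambda$ as a surjection $X\to X_\lambda$, and let $p_\lambda:X_\lambda\to G_\lambda$ be the projection onto the first coordinate. For $\lambda\prec\mu$ in $\Lambda_\alpha$ let $h_\lambda^\mu:X_\mu\to X_\lambda$ be the (well-defined, continuous) mapping with $h_\lambda^\mu(h_\mu(x))=h_\lambda(x)$ for $x\in X$. *)

theory Defs
  imports "HOL-Analysis.Analysis" "HOL-Algebra.Product_Groups"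
begin

section \<open>Finite-sheeted coverings\<close>

definition slice_partition ::
  "nat \<Rightarrow> 'x topology \<Rightarrow> 'y topology \<Rightarrow> ('x \<Rightarrow> 'y) \<Rightarrow> 'y set \<Rightarrow> (nat \<Rightarrow> 'x set) \<Rightarrow> bool"
  where "slice_partition k X Y p W V \<longleftrightarrow>
    openin Y W \<and>
    (\<Union>l\<in>{1..k}. V l) = {x \<in> topspace X. p x \<in> W} \<and>
    disjoint_family_on V {1..k} \<and>
    (\<forall>l\<in>{1..k}. openin X (V l) \<and>
       homeomorphic_map (subtopology X (V l)) (subtopology Y W) p)"

definition evenly_covered ::
  "nat \<Rightarrow> 'x topology \<Rightarrow> 'y topology \<Rightarrow> ('x \<Rightarrow> 'y) \<Rightarrow> 'y set \<Rightarrow> bool"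
  where "evenly_covered k X Y p W \<longleftrightarrow> (\<exists>V. slice_partition k X Y p W V)"

definition k_fold_covering ::
  "nat \<Rightarrow> 'x topology \<Rightarrow> 'y topology \<Rightarrow> ('x \<Rightarrow> 'y) \<Rightarrow> bool"
  where "k_fold_covering k X Y p \<longleftrightarrow>
    continuous_map X Y p \<and> p ` topspace X = topspace Y \<and>
    (\<forall>y \<in> topspace Y. \<exists>W. y \<in> W \<and> evenly_covered k X Y p W)"


section \<open>Inverse systems of spaces\<close>

definition directed_index_set :: "'i set \<Rightarrow> ('i \<Rightarrow> 'i \<Rightarrow> bool) \<Rightarrow> bool"
  where "directed_index_set \<Lambda> prec \<longleftrightarrow>
    \<Lambda> \<noteq> {} \<and>
    (\<forall>i\<in>\<Lambda>. prec i i) \<and>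
    (\<forall>i\<in>\<Lambda>. \<forall>j\<in>\<Lambda>. \<forall>l\<in>\<Lambda>. prec i j \<longrightarrow> prec j l \<longrightarrow> prec i l) \<and>
    (\<forall>i\<in>\<Lambda>. \<forall>j\<in>\<Lambda>. \<exists>l\<in>\<Lambda>. prec i l \<and> prec j l)"

definition index_above :: "'i set \<Rightarrow> ('i \<Rightarrow> 'i \<Rightarrow> bool) \<Rightarrow> 'i \<Rightarrow> 'i set"
  where "index_above \<Lambda> prec \<nu> = {i \<in> \<Lambda>. prec \<nu> i}"

text \<open>For \<open>prec i j\<close> the bonding map \<open>b i j\<close> goes from \<open>Y j\<close> to \<open>Y i\<close>.\<close>

definition inverse_system ::
  "'i set \<Rightarrow> ('i \<Rightarrow> 'i \<Rightarrow> bool) \<Rightarrow> ('i \<Rightarrow> 'y topology) \<Rightarrow> ('i \<Rightarrow> 'i \<Rightarrow> 'y \<Rightarrow> 'y) \<Rightarrow> bool"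
  where "inverse_system \<Lambda> prec Y b \<longleftrightarrow>
    directed_index_set \<Lambda> prec \<and>
    (\<forall>i\<in>\<Lambda>. \<forall>j\<in>\<Lambda>. prec i j \<longrightarrow> continuous_map (Y j) (Y i) (b i j)) \<and>
    (\<forall>i\<in>\<Lambda>. \<forall>y \<in> topspace (Y i). b i i y = y) \<and>
    (\<forall>i\<in>\<Lambda>. \<forall>j\<in>\<Lambda>. \<forall>l\<in>\<Lambda>. prec i j \<longrightarrow> prec j l \<longrightarrow>
       (\<forall>y \<in> topspace (Y l). b i l y = b i j (b j l y)))"

definition threads ::
  "'i set \<Rightarrow> ('i \<Rightarrow> 'i \<Rightarrow> bool) \<Rightarrow> ('i \<Rightarrow> 'y topology) \<Rightarrow> ('i \<Rightarrow> 'i \<Rightarrow> 'y \<Rightarrow> 'y) \<Rightarrow> ('i \<Rightarrow> 'y) set"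
  where "threads \<Lambda> prec Y b =
    {y \<in> (\<Pi>\<^sub>E i\<in>\<Lambda>. topspace (Y i)). \<forall>i\<in>\<Lambda>. \<forall>j\<in>\<Lambda>. prec i j \<longrightarrow> b i j (y j) = y i}"

definition limit_topology ::
  "'i set \<Rightarrow> ('i \<Rightarrow> 'i \<Rightarrow> bool) \<Rightarrow> ('i \<Rightarrow> 'y topology) \<Rightarrow> ('i \<Rightarrow> 'i \<Rightarrow> 'y \<Rightarrow> 'y) \<Rightarrow> ('i \<Rightarrow> 'y) topology"
  where "limit_topology \<Lambda> prec Y b = subtopology (product_topology Y \<Lambda>) (threads \<Lambda> prec Y b)"

definition system_morphism ::
  "'i set \<Rightarrow> ('i \<Rightarrow> 'i \<Rightarrow> bool) \<Rightarrow>
   ('i \<Rightarrow> 'x topology) \<Rightarrow> ('i \<Rightarrow> 'i \<Rightarrow> 'x \<Rightarrow> 'x) \<Rightarrow>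
   ('i \<Rightarrow> 'y topology) \<Rightarrow> ('i \<Rightarrow> 'i \<Rightarrow> 'y \<Rightarrow> 'y) \<Rightarrow> ('i \<Rightarrow> 'x \<Rightarrow> 'y) \<Rightarrow> bool"
  where "system_morphism \<Lambda> prec X b Y c \<tau> \<longleftrightarrow>
    (\<forall>i\<in>\<Lambda>. continuous_map (X i) (Y i) (\<tau> i)) \<and>
    (\<forall>i\<in>\<Lambda>. \<forall>j\<in>\<Lambda>. prec i j \<longrightarrow> (\<forall>x \<in> topspace (X j). \<tau> i (b i j x) = c i j (\<tau> j x)))"

definition limit_morphism :: "'i set \<Rightarrow> ('i \<Rightarrow> 'x \<Rightarrow> 'y) \<Rightarrow> ('i \<Rightarrow> 'x) \<Rightarrow> ('i \<Rightarrow> 'y)"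
  where "limit_morphism \<Lambda> \<tau> x = (\<lambda>i\<in>\<Lambda>. \<tau> i (x i))"

definition is_limit_morphism_up_to_iso ::
  "'i set \<Rightarrow> ('i \<Rightarrow> 'i \<Rightarrow> bool) \<Rightarrow>
   ('i \<Rightarrow> 'x topology) \<Rightarrow> ('i \<Rightarrow> 'i \<Rightarrow> 'x \<Rightarrow> 'x) \<Rightarrow>
   ('i \<Rightarrow> 'y topology) \<Rightarrow> ('i \<Rightarrow> 'i \<Rightarrow> 'y \<Rightarrow> 'y) \<Rightarrow> ('i \<Rightarrow> 'x \<Rightarrow> 'y) \<Rightarrow>
   's topology \<Rightarrow> 't topology \<Rightarrow> ('s \<Rightarrow> 't) \<Rightarrow> bool"
  where "is_limit_morphism_up_to_iso \<Lambda> prec X b Y c \<tau> S T t \<longleftrightarrow>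
    (\<exists>\<rho> \<sigma>. homeomorphic_map S (limit_topology \<Lambda> prec X b) \<rho> \<and>
           homeomorphic_map T (limit_topology \<Lambda> prec Y c) \<sigma> \<and>
           (\<forall>s \<in> topspace S. limit_morphism \<Lambda> \<tau> (\<rho> s) = \<sigma> (t s)))"


section \<open>Compact groups and their inverse limits\<close>

definition topological_group :: "('g, 'r) monoid_scheme \<Rightarrow> 'g topology \<Rightarrow> bool"
  where "topological_group G T \<longleftrightarrow>
    group G \<and> topspace T = carrier G \<and>
    continuous_map (prod_topology T T) T (\<lambda>(x, y). x \<otimes>\<^bsub>G\<^esub> y) \<and>
    continuous_map T T (\<lambda>x. inv\<^bsub>G\<^esub> x)"

definition compact_group :: "('g, 'r) monoid_scheme \<Rightarrow> 'g topology \<Rightarrow> bool"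
  where "compact_group G T \<longleftrightarrow> topological_group G T \<and> compact_space T \<and> Hausdorff_space T"

definition compact_group_system ::
  "'i set \<Rightarrow> ('i \<Rightarrow> 'i \<Rightarrow> bool) \<Rightarrow> ('i \<Rightarrow> ('h, 'r) monoid_scheme) \<Rightarrow> ('i \<Rightarrow> 'h topology) \<Rightarrow>
   ('i \<Rightarrow> 'i \<Rightarrow> 'h \<Rightarrow> 'h) \<Rightarrow> bool"
  where "compact_group_system \<Lambda> prec H T b \<longleftrightarrow>
    (\<forall>i\<in>\<Lambda>. compact_group (H i) (T i)) \<and>
    inverse_system \<Lambda> prec T b \<and>
    (\<forall>i\<in>\<Lambda>. \<forall>j\<in>\<Lambda>. prec i j \<longrightarrow> b i j \<in> hom (H j) (H i))"

text \<open>The cone \<open>(G, \<pi>)\<close> is a limit iff the map it induces into the group of threads (a subgroup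
  of the product) is an isomorphism of topological groups.  That each \<open>\<pi> i\<close> is a continuous
  homomorphism and that \<open>b i j \<circ> \<pi> j = \<pi> i\<close> is part of this.\<close>

definition is_compact_group_limit ::
  "'i set \<Rightarrow> ('i \<Rightarrow> 'i \<Rightarrow> bool) \<Rightarrow> ('i \<Rightarrow> ('h, 'r) monoid_scheme) \<Rightarrow> ('i \<Rightarrow> 'h topology) \<Rightarrow>
   ('i \<Rightarrow> 'i \<Rightarrow> 'h \<Rightarrow> 'h) \<Rightarrow> ('g, 's) monoid_scheme \<Rightarrow> 'g topology \<Rightarrow> ('i \<Rightarrow> 'g \<Rightarrow> 'h) \<Rightarrow> bool"
  where "is_compact_group_limit \<Lambda> prec H T b G S \<pi> \<longleftrightarrow>
    (\<lambda>x. \<lambda>i\<in>\<Lambda>. \<pi> i x) \<in> iso G ((product_group \<Lambda> H)\<lparr>carrier := threads \<Lambda> prec T b\<rparr>) \<and>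
    homeomorphic_map S (limit_topology \<Lambda> prec T b) (\<lambda>x. \<lambda>i\<in>\<Lambda>. \<pi> i x)"


section \<open>Lie groups\<close>

text \<open>\<open>C_diff n S r f\<close>: the real function \<open>f\<close> is \<open>r\<close> times continuously differentiable on \<open>S\<close>,
  where \<open>S\<close> is an open subset of \<open>n\<close>-space, modelled by \<^const>\<open>Euclidean_space\<close>.\<close>

primrec C_diff :: "nat \<Rightarrow> (nat \<Rightarrow> real) set \<Rightarrow> nat \<Rightarrow> ((nat \<Rightarrow> real) \<Rightarrow> real) \<Rightarrow> bool"
  where
    "C_diff n S 0 f \<longleftrightarrow> continuous_map (subtopology (Euclidean_space n) S) euclideanreal f"
  | "C_diff n S (Suc r) f \<longleftrightarrow>
       continuous_map (subtopology (Euclidean_space n) S) euclideanreal f \<and>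
       (\<forall>i<n. \<exists>D. (\<forall>x\<in>S. ((\<lambda>t. f (x(i := t))) has_real_derivative D x) (at (x i))) \<and>
                  C_diff n S r D)"

definition smooth_map :: "nat \<Rightarrow> (nat \<Rightarrow> real) set \<Rightarrow> nat \<Rightarrow> ((nat \<Rightarrow> real) \<Rightarrow> nat \<Rightarrow> real) \<Rightarrow> bool"
  where "smooth_map n S d f \<longleftrightarrow> (\<forall>j<d. \<forall>r. C_diff n S r (\<lambda>x. f x j))"

definition is_chart :: "'a topology \<Rightarrow> nat \<Rightarrow> 'a set \<times> ('a \<Rightarrow> nat \<Rightarrow> real) \<Rightarrow> bool"
  where "is_chart T n = (\<lambda>(U, \<phi>). openin T U \<and> openin (Euclidean_space n) (\<phi> ` U) \<and>
    homeomorphic_map (subtopology T U) (subtopology (Euclidean_space n) (\<phi> ` U)) \<phi>)"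

definition smooth_atlas :: "'a topology \<Rightarrow> nat \<Rightarrow> ('a set \<times> ('a \<Rightarrow> nat \<Rightarrow> real)) set \<Rightarrow> bool"
  where "smooth_atlas T n A \<longleftrightarrow>
    (\<forall>c\<in>A. is_chart T n c) \<and> (\<Union>c\<in>A. fst c) = topspace T \<and>
    (\<forall>(U, \<phi>)\<in>A. \<forall>(V, \<psi>)\<in>A.
       smooth_map n (\<phi> ` (U \<inter> V)) n (\<lambda>x. \<psi> (inv_into U \<phi> x)))"

text \<open>The product of two charts takes values in \<open>(n + n)\<close>-space; these are its two halves.\<close>

definition first_half :: "nat \<Rightarrow> (nat \<Rightarrow> real) \<Rightarrow> nat \<Rightarrow> real"
  where "first_half n z = (\<lambda>i. if i < n then z i else 0)"

definition second_half :: "nat \<Rightarrow> (nat \<Rightarrow> real) \<Rightarrow> nat \<Rightarrow> real"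
  where "second_half n z = (\<lambda>i. if i < n then z (n + i) else 0)"

definition smooth_mult ::
  "('a, 'r) monoid_scheme \<Rightarrow> nat \<Rightarrow> ('a set \<times> ('a \<Rightarrow> nat \<Rightarrow> real)) set \<Rightarrow> bool"
  where "smooth_mult G n A \<longleftrightarrow>
    (\<forall>(U, \<phi>)\<in>A. \<forall>(V, \<psi>)\<in>A. \<forall>(W, \<theta>)\<in>A.
       smooth_map (n + n)
         {z \<in> topspace (Euclidean_space (n + n)).
            first_half n z \<in> \<phi> ` U \<and> second_half n z \<in> \<psi> ` V \<and>
            inv_into U \<phi> (first_half n z) \<otimes>\<^bsub>G\<^esub> inv_into V \<psi> (second_half n z) \<in> W}
         n (\<lambda>z. \<theta> (inv_into U \<phi> (first_half n z) \<otimes>\<^bsub>G\<^esub> inv_into V \<psi> (second_half n z))))"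

definition smooth_inv ::
  "('a, 'r) monoid_scheme \<Rightarrow> nat \<Rightarrow> ('a set \<times> ('a \<Rightarrow> nat \<Rightarrow> real)) set \<Rightarrow> bool"
  where "smooth_inv G n A \<longleftrightarrow>
    (\<forall>(U, \<phi>)\<in>A. \<forall>(V, \<psi>)\<in>A.
       smooth_map n {x \<in> \<phi> ` U. inv\<^bsub>G\<^esub> (inv_into U \<phi> x) \<in> V}
         n (\<lambda>x. \<psi> (inv\<^bsub>G\<^esub> (inv_into U \<phi> x))))"

definition Lie_group :: "('a, 'r) monoid_scheme \<Rightarrow> 'a topology \<Rightarrow> bool"
  where "Lie_group G T \<longleftrightarrow>
    topological_group G T \<and> Hausdorff_space T \<and> second_countable T \<and>
    (\<exists>n A. smooth_atlas T n A \<and> smooth_mult G n A \<and> smooth_inv G n A)"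

end

theory Submission
  imports Defs
begin

text \<open>
The point is that the values \<open>fhat\<close> remember the sheets of \<open>p\<close>, and that every late stage
\<open>\<pi> i : G \<rightarrow> G_i\<close> is fine enough for this memory to survive the passage to \<open>G_i\<close>.

Over a point of positive weight \<open>\<phi> n\<close>, the value \<open>fhat n x\<close> is the weight times a \<open>k\<close>-th root of
unity naming the slice \<open>V n l\<close> that contains \<open>x\<close>.  So \<open>p x\<close> and the values \<open>fhat n x\<close> together
determine \<open>x\<close>.  In the stage \<open>X_i\<close>, however, \<open>p x\<close> is only known up to a fibre of \<open>\<pi> i\<close>, and two
points of one slice \<open>V n l\<close> over such a fibre might lie in different slices of another index \<open>n'\<close>;
then \<open>X_i\<close> would have too many points.  The images \<open>p (V n l \<inter> V n' l')\<close>, for \<open>l'\<close> ranging over the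
sheets, form an open cover of the compact set where the supports of \<open>\<phi> n\<close> and \<open>\<phi> n'\<close> meet.  By a
Lebesgue number argument (\<open>fibres_refine_open_cover\<close>) there is a \<open>\<beta>\<close> such that for all \<open>i\<close>
above \<open>\<beta>\<close> each fibre of \<open>\<pi> i\<close> over this set lies in one of these images.  Since there are only finitely
many triples \<open>(n, n', l)\<close>, one \<open>\<beta>\<close> serves all of them, and from \<open>\<beta>\<close> on a single value \<open>fhat n x\<close>
with positive weight determines all the others (\<open>fhat_determined_by_slice\<close>).

For such \<open>i\<close> the images under \<open>h i\<close> of the slices over \<open>{\<phi> n > 0}\<close> are pairwise disjoint, and on
each of them \<open>p_i\<close> is injective.  They are open because \<open>h i\<close> is a quotient map (from a compact
space to a Hausdorff space) and their preimages are open; and \<open>p_i\<close> is open because \<open>p_i \<circ> h_i\<close> is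
the open map \<open>\<pi>_i \<circ> p\<close>.  This makes \<open>p_i\<close> a \<open>k\<close>-fold covering (\<open>stage_covering\<close>).

The maps \<open>h i\<close> induce a continuous map of the compact space \<open>X\<close> to the Hausdorff limit of the \<open>X_i\<close>.
It is injective because the values \<open>fhat n x\<close> single out the sheet, and surjective because a thread
of the \<open>X_i\<close> lies over a thread of the \<open>G_i\<close>, that is over some \<open>g \<in> G\<close>, and prescribes one sheet in
which to lift \<open>g\<close> (\<open>total_limit\<close>).
\<close>

section \<open>Inverse limits of spaces\<close>

lemma directed_index_above:
  assumes "directed_index_set \<Lambda> prec" "\<beta> \<in> \<Lambda>"
  shows "directed_index_set (index_above \<Lambda> prec \<beta>) prec"
  unfolding directed_index_set_def
proof (intro conjI)
  have refl: "prec \<beta> \<beta>" using assms by (simp add: directed_index_set_def)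
  then show "index_above \<Lambda> prec \<beta> \<noteq> {}"
    using assms by (auto simp: index_above_def)
  show "\<forall>i\<in>index_above \<Lambda> prec \<beta>. prec i i"
    using assms by (auto simp: index_above_def directed_index_set_def)
  show "\<forall>i\<in>index_above \<Lambda> prec \<beta>. \<forall>j\<in>index_above \<Lambda> prec \<beta>. \<forall>l\<in>index_above \<Lambda> prec \<beta>.
          prec i j \<longrightarrow> prec j l \<longrightarrow> prec i l"
    using assms unfolding index_above_def directed_index_set_def by blast
  show "\<forall>i\<in>index_above \<Lambda> prec \<beta>. \<forall>j\<in>index_above \<Lambda> prec \<beta>.
          \<exists>l\<in>index_above \<Lambda> prec \<beta>. prec i l \<and> prec j l"
    using assms unfolding index_above_def directed_index_set_def by blast
qed

lemma inverse_system_index_above: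
  assumes "inverse_system \<Lambda> prec Y b" "\<beta> \<in> \<Lambda>"
  shows "inverse_system (index_above \<Lambda> prec \<beta>) prec Y b"
  using assms directed_index_above[of \<Lambda> prec \<beta>]
  unfolding inverse_system_def by (simp add: index_above_def)

lemma directed_index_set_finite_upper_bound:
  assumes "directed_index_set \<Lambda> prec" "finite F" "F \<subseteq> \<Lambda>"
  shows "\<exists>u\<in>\<Lambda>. \<forall>i\<in>F. prec i u"
  using assms(2,3)
proof (induction F rule: finite_induct)
  case empty
  then show ?case using assms(1) unfolding directed_index_set_def by blast
next
  case (insert i F)
  then obtain u where u: "u \<in> \<Lambda>" "\<forall>j\<in>F. prec j u" by auto
  obtain v where v: "v \<in> \<Lambda>" "prec i v" "prec u v"
    using assms(1) insert.prems u(1) unfolding directed_index_set_def by blast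
  have "prec j v" if "j \<in> F" for j
    using assms(1) insert.prems u v that unfolding directed_index_set_def by blast
  with v show ?case by blast
qed

lemma threadsD:
  assumes "y \<in> threads \<Lambda> prec Y b" "i \<in> \<Lambda>"
  shows "y i \<in> topspace (Y i)"
    and "\<And>j. j \<in> \<Lambda> \<Longrightarrow> prec i j \<Longrightarrow> b i j (y j) = y i"
  using assms by (auto simp: threads_def)

lemma topspace_limit_topology:
  "topspace (limit_topology \<Lambda> prec Y b) = threads \<Lambda> prec Y b"
  by (auto simp: limit_topology_def threads_def)

lemma Hausdorff_space_limit_topology:
  assumes "\<And>i. i \<in> \<Lambda> \<Longrightarrow> Hausdorff_space (Y i)"
  shows "Hausdorff_space (limit_topology \<Lambda> prec Y b)"
  unfolding limit_topology_def
  by (intro Hausdorff_space_subtopology) (simp add: Hausdorff_space_product_topology assms)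

lemma continuous_map_into_limit_topology:
  assumes "\<And>i. i \<in> \<Lambda> \<Longrightarrow> continuous_map S (Y i) (\<lambda>s. g s i)"
    and "\<And>s. s \<in> topspace S \<Longrightarrow> g s \<in> threads \<Lambda> prec Y b"
  shows "continuous_map S (limit_topology \<Lambda> prec Y b) g"
  unfolding limit_topology_def continuous_map_in_subtopology continuous_map_componentwise
  using assms by (auto simp: threads_def PiE_def)

lemma continuous_map_limit_projection:
  assumes "i \<in> \<Lambda>"
  shows "continuous_map (limit_topology \<Lambda> prec Y b) (Y i) (\<lambda>y. y i)"
  unfolding limit_topology_def
  using assms by (intro continuous_map_from_subtopology continuous_map_product_projection)

text \<open>The coordinate at an arbitrary index is the image of the coordinate at any later index above
  \<open>\<beta>\<close>; by directedness the choice of the later index does not matter.\<close>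

lemma thread_extension:
  assumes sys: "inverse_system \<Lambda> prec Y b" and "\<beta> \<in> \<Lambda>"
    and y: "y \<in> threads (index_above \<Lambda> prec \<beta>) prec Y b"
  obtains z where "z \<in> threads \<Lambda> prec Y b" "\<And>i. i \<in> index_above \<Lambda> prec \<beta> \<Longrightarrow> z i = y i"
proof -
  let ?B = "index_above \<Lambda> prec \<beta>"
  have dir: "directed_index_set \<Lambda> prec" using sys by (simp add: inverse_system_def)
  have tr: "prec i l" if "i \<in> \<Lambda>" "j \<in> \<Lambda>" "l \<in> \<Lambda>" "prec i j" "prec j l" for i j l
    using dir that unfolding directed_index_set_def by blast
  have "\<forall>i\<in>\<Lambda>. \<exists>u. u \<in> ?B \<and> prec i u"
    using dir \<open>\<beta> \<in> \<Lambda>\<close> unfolding directed_index_set_def index_above_def by blast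
  then obtain u where u: "\<And>i. i \<in> \<Lambda> \<Longrightarrow> u i \<in> ?B" "\<And>i. i \<in> \<Lambda> \<Longrightarrow> prec i (u i)"
    by metis
  have B: "?B \<subseteq> \<Lambda>" by (auto simp: index_above_def)
  define z where "z = (\<lambda>i\<in>\<Lambda>. b i (u i) (y (u i)))"
  have cont: "b i j x \<in> topspace (Y i)"
    if "i \<in> \<Lambda>" "j \<in> \<Lambda>" "prec i j" "x \<in> topspace (Y j)" for i j x
    using sys that continuous_map_image_subset_topspace unfolding inverse_system_def by blast
  have comp: "b i l x = b i j (b j l x)"
    if "i \<in> \<Lambda>" "j \<in> \<Lambda>" "l \<in> \<Lambda>" "prec i j" "prec j l" "x \<in> topspace (Y l)" for i j l x
    using sys that unfolding inverse_system_def by blast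
  have yt: "y j \<in> topspace (Y j)" if "j \<in> ?B" for j
    using threadsD(1)[OF y that] .
  have indep: "b i j (y j) = b i l (y l)"
    if "i \<in> \<Lambda>" "j \<in> ?B" "l \<in> ?B" "prec i j" "prec j l" for i j l
  proof -
    have "j \<in> \<Lambda>" "l \<in> \<Lambda>" using that B by blast+
    then show ?thesis
      using comp[of i j l "y l"] threadsD(2)[OF y that(2,3,5)] yt[OF that(3)] that by simp
  qed
  have z_eq: "z i = b i j (y j)" if i: "i \<in> \<Lambda>" and j: "j \<in> ?B" "prec i j" for i j
  proof -
    obtain l where "l \<in> ?B" "prec j l" "prec (u i) l"
      using directed_index_above[OF dir \<open>\<beta> \<in> \<Lambda>\<close>] j(1) u(1)[OF i]
      unfolding directed_index_set_def by blast
    then show ?thesis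
      using indep[OF i j(1) _ j(2)] indep[OF i u(1)[OF i] _ u(2)[OF i]] i by (simp add: z_def)
  qed
  show thesis
  proof
    show "z \<in> threads \<Lambda> prec Y b"
      unfolding threads_def
    proof (intro CollectI conjI PiE_I ballI impI)
      fix i assume i: "i \<in> \<Lambda>"
      have ui: "u i \<in> \<Lambda>" using u(1)[OF i] B by blast
      show "z i \<in> topspace (Y i)"
        using cont[OF i ui u(2)[OF i] yt[OF u(1)[OF i]]] i by (simp add: z_def)
    next
      fix i j assume ij: "i \<in> \<Lambda>" "j \<in> \<Lambda>" "prec i j"
      have uj: "u j \<in> \<Lambda>" using u(1)[OF ij(2)] B by blast
      have "b i j (z j) = b i (u j) (y (u j))"
        using comp[OF ij(1,2) uj ij(3) u(2)[OF ij(2)] yt[OF u(1)[OF ij(2)]]] ij by (simp add: z_def)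
      also have "\<dots> = z i"
        using z_eq[OF ij(1) u(1)[OF ij(2)] tr[OF ij(1,2) uj ij(3) u(2)[OF ij(2)]]] by simp
      finally show "b i j (z j) = z i" .
    qed (simp add: z_def)
    show "z i = y i" if i: "i \<in> ?B" for i
    proof -
      have "prec i i" using dir i B unfolding directed_index_set_def by blast
      then show ?thesis using z_eq[of i i] threadsD(2)[OF y i i] i B by auto
    qed
  qed
qed

text \<open>Directedness turns a finite intersection of coordinate conditions into one condition on a
  single coordinate further up.\<close>

lemma limit_topology_base:
  assumes sys: "inverse_system \<Lambda> prec Y b"
    and open_N: "openin (limit_topology \<Lambda> prec Y b) N" and y: "y \<in> N"
  obtains i Q where "i \<in> \<Lambda>" "openin (Y i) Q" "y i \<in> Q"
    "\<And>z. z \<in> threads \<Lambda> prec Y b \<Longrightarrow> z i \<in> Q \<Longrightarrow> z \<in> N"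
proof -
  obtain P where P: "openin (product_topology Y \<Lambda>) P" "N = P \<inter> threads \<Lambda> prec Y b"
    using open_N unfolding limit_topology_def openin_subtopology by blast
  have "y \<in> P" using P(2) y by blast
  then have "\<exists>D. finite {i\<in>\<Lambda>. D i \<noteq> topspace (Y i)} \<and> (\<forall>i\<in>\<Lambda>. openin (Y i) (D i)) \<and>
      y \<in> Pi\<^sub>E \<Lambda> D \<and> Pi\<^sub>E \<Lambda> D \<subseteq> P"
    using P(1) unfolding openin_product_topology_alt by simp
  then obtain D where D: "finite {i\<in>\<Lambda>. D i \<noteq> topspace (Y i)}" "\<And>i. i \<in> \<Lambda> \<Longrightarrow> openin (Y i) (D i)"
      "y \<in> Pi\<^sub>E \<Lambda> D" "Pi\<^sub>E \<Lambda> D \<subseteq> P"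
    by (elim exE conjE) (rule that; blast)
  let ?F = "{i\<in>\<Lambda>. D i \<noteq> topspace (Y i)}"
  obtain u where u: "u \<in> \<Lambda>" "\<forall>i\<in>?F. prec i u"
    using directed_index_set_finite_upper_bound[of \<Lambda> prec ?F] D(1) sys
    unfolding inverse_system_def by blast
  have yt: "y \<in> threads \<Lambda> prec Y b" using y P by blast
  define Q where "Q = (\<Inter>i\<in>?F. {x \<in> topspace (Y u). b i u x \<in> D i}) \<inter> topspace (Y u)"
  show thesis
  proof
    show "u \<in> \<Lambda>" by fact
    have "continuous_map (Y u) (Y i) (b i u)" if "i \<in> ?F" for i
      using sys u that unfolding inverse_system_def by blast
    then have "openin (Y u) {x \<in> topspace (Y u). b i u x \<in> D i}" if "i \<in> ?F" for i
      using D(2) that by (intro openin_continuous_map_preimage) auto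
    then show "openin (Y u) Q"
      unfolding Q_def by (rule openin_INT[OF D(1)])
    show "y u \<in> Q"
      unfolding Q_def using threadsD[OF yt] u D(3) by (auto simp: PiE_iff)
    show "z \<in> N" if z: "z \<in> threads \<Lambda> prec Y b" "z u \<in> Q" for z
    proof -
      have "z i \<in> D i" if i: "i \<in> \<Lambda>" for i
      proof (cases "i \<in> ?F")
        case True
        then have "b i u (z u) \<in> D i" using z(2) unfolding Q_def by blast
        moreover have "prec i u" using u(2) True by blast
        ultimately show ?thesis using threadsD(2)[OF z(1) i u(1)] by simp
      next
        case False
        then show ?thesis using threadsD(1)[OF z(1) i] i by simp
      qed
      moreover have "z \<in> extensional \<Lambda>" using z(1) by (auto simp: threads_def PiE_def)
      ultimately have "z \<in> Pi\<^sub>E \<Lambda> D" by (simp add: PiE_iff)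
      then show ?thesis using D(4) P(2) z(1) by blast
    qed
  qed
qed

text \<open>A Lebesgue number lemma, with late indices in place of small radii.  Around each point of \<open>C\<close>
  some member of the cover contains the preimage under one \<open>\<pi> i\<close> of an open set, hence every fibre
  of \<open>\<pi> i\<close> that meets this preimage; fibres only shrink at later indices, so an upper bound of
  finitely many such \<open>i\<close> works for all of \<open>C\<close>.\<close>

lemma fibres_refine_open_cover:
  assumes sys: "inverse_system \<Lambda> prec Y b"
    and lim: "homeomorphic_map S (limit_topology \<Lambda> prec Y b) (\<lambda>x. \<lambda>i\<in>\<Lambda>. \<pi> i x)"
    and C: "compactin S C" and op: "\<And>A. A \<in> \<A> \<Longrightarrow> openin S A" and cov: "C \<subseteq> \<Union>\<A>"
  shows "\<exists>u\<in>\<Lambda>. \<forall>i\<in>\<Lambda>. prec u i \<longrightarrow>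
    (\<forall>g\<in>C. \<exists>A\<in>\<A>. \<forall>g'\<in>topspace S. \<pi> i g' = \<pi> i g \<longrightarrow> g' \<in> A)"
proof -
  let ?L = "limit_topology \<Lambda> prec Y b"
  let ?t = "\<lambda>x. \<lambda>i\<in>\<Lambda>. \<pi> i x"
  have dir: "directed_index_set \<Lambda> prec" using sys by (simp add: inverse_system_def)
  have thr: "?t g \<in> threads \<Lambda> prec Y b" if "g \<in> topspace S" for g
    using lim that homeomorphic_imp_surjective_map topspace_limit_topology by blast
  have inj: "inj_on ?t (topspace S)" using lim homeomorphic_imp_injective_map by blast
  have cS: "C \<subseteq> topspace S" using C compactin_subset_topspace by blast
  have "\<exists>i Q A. i \<in> \<Lambda> \<and> openin S Q \<and> g \<in> Q \<and> A \<in> \<A> \<and>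
          (\<forall>x\<in>Q. \<forall>g'\<in>topspace S. \<pi> i g' = \<pi> i x \<longrightarrow> g' \<in> A)" if g: "g \<in> C" for g
  proof -
    obtain A where A: "A \<in> \<A>" "g \<in> A" using cov g by blast
    have "openin ?L (?t ` A)" using op[OF A(1)] lim homeomorphic_imp_open_map
      unfolding open_map_def by blast
    then obtain i Q where i: "i \<in> \<Lambda>" and Q: "openin (Y i) Q" "?t g i \<in> Q"
      "\<And>z. z \<in> threads \<Lambda> prec Y b \<Longrightarrow> z i \<in> Q \<Longrightarrow> z \<in> ?t ` A"
      using limit_topology_base[OF sys, of "?t ` A" "?t g"] A(2) by blast
    have sub: "g' \<in> A" if g': "g' \<in> topspace S" "\<pi> i g' \<in> Q" for g'
    proof -
      have "?t g' \<in> ?t ` A" using Q(3)[OF thr[OF g'(1)]] g'(2) i by simp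
      then show ?thesis
        using inj_on_image_mem_iff[OF inj g'(1) openin_subset[OF op[OF A(1)]]] by simp
    qed
    have "continuous_map S (Y i) (\<lambda>g. ?t g i)"
      using continuous_map_compose[OF homeomorphic_imp_continuous_map[OF lim]
          continuous_map_limit_projection[OF i]] by (simp add: o_def)
    then have "openin S {x \<in> topspace S. \<pi> i x \<in> Q}"
      using openin_continuous_map_preimage[OF _ Q(1), of S "\<lambda>g. ?t g i"] i by simp
    moreover have "g \<in> {x \<in> topspace S. \<pi> i x \<in> Q}" using g cS Q(2) i by auto
    ultimately show ?thesis using i A(1) sub by (metis (mono_tags, lifting) mem_Collect_eq)
  qed
  then obtain i Q A where iQA: "\<And>g. g \<in> C \<Longrightarrow> i g \<in> \<Lambda> \<and> openin S (Q g) \<and> g \<in> Q g \<and> A g \<in> \<A> \<and>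
          (\<forall>x\<in>Q g. \<forall>g'\<in>topspace S. \<pi> (i g) g' = \<pi> (i g) x \<longrightarrow> g' \<in> A g)"
    by metis
  have "\<exists>\<F>. finite \<F> \<and> \<F> \<subseteq> Q ` C \<and> C \<subseteq> \<Union>\<F>"
    using C iQA unfolding compactin_def by (auto dest!: spec[of _ "Q ` C"])
  then obtain \<F> where \<F>: "finite \<F>" "\<F> \<subseteq> Q ` C" "C \<subseteq> \<Union>\<F>" by blast
  obtain F where F: "finite F" "F \<subseteq> C" "C \<subseteq> \<Union>(Q ` F)"
    using finite_subset_image[OF \<F>(1,2)] \<F>(3) by metis
  obtain u where u: "u \<in> \<Lambda>" "\<forall>j\<in>i ` F. prec j u"
    using directed_index_set_finite_upper_bound[OF dir, of "i ` F"] F iQA by auto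
  show ?thesis
  proof (intro bexI[OF _ u(1)] ballI impI)
    fix j g assume j: "j \<in> \<Lambda>" "prec u j" and g: "g \<in> C"
    obtain a where a: "a \<in> F" "g \<in> Q a" using F g by blast
    have aC: "a \<in> C" using a F by blast
    have ia: "i a \<in> \<Lambda>" "prec (i a) j"
      using iQA[OF aC] u a j dir unfolding directed_index_set_def by blast+
    have down: "\<pi> (i a) x = b (i a) j (\<pi> j x)" if "x \<in> topspace S" for x
      using threadsD(2)[OF thr[OF that] ia(1) j(1) ia(2)] ia j by simp
    show "\<exists>A\<in>\<A>. \<forall>g'\<in>topspace S. \<pi> j g' = \<pi> j g \<longrightarrow> g' \<in> A"
    proof (intro bexI[of _ "A a"] ballI impI)
      fix g' assume g': "g' \<in> topspace S" "\<pi> j g' = \<pi> j g"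
      have "\<pi> (i a) g' = \<pi> (i a) g" using down g' g cS by auto
      then show "g' \<in> A a" using iQA[OF aC] a(2) g'(1) by blast
    qed (use iQA[OF aC] in blast)
  qed
qed

text \<open>Cofinal restriction does not change the limit.  On the compact space \<open>S\<close> it is enough that
restricting threads is bijective: injectivity is directedness, surjectivity is \<open>thread_extension\<close>.\<close>

lemma homeomorphic_map_limit_index_above:
  assumes sys: "inverse_system \<Lambda> prec Y b"
    and lim: "homeomorphic_map S (limit_topology \<Lambda> prec Y b) (\<lambda>x. \<lambda>i\<in>\<Lambda>. \<pi> i x)"
    and comp: "compact_space S" and Haus: "\<And>i. i \<in> \<Lambda> \<Longrightarrow> Hausdorff_space (Y i)"
    and \<beta>: "\<beta> \<in> \<Lambda>"
  shows "homeomorphic_map S (limit_topology (index_above \<Lambda> prec \<beta>) prec Y b)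
           (\<lambda>x. \<lambda>i\<in>index_above \<Lambda> prec \<beta>. \<pi> i x)"
proof (rule continuous_imp_homeomorphic_map)
  let ?B = "index_above \<Lambda> prec \<beta>"
  let ?t = "\<lambda>x. \<lambda>i\<in>\<Lambda>. \<pi> i x"
  let ?s = "\<lambda>x. \<lambda>i\<in>?B. \<pi> i x"
  have B: "?B \<subseteq> \<Lambda>" by (auto simp: index_above_def)
  have dir: "directed_index_set \<Lambda> prec" using sys by (simp add: inverse_system_def)
  have im: "?t ` topspace S = threads \<Lambda> prec Y b"
    using lim homeomorphic_imp_surjective_map topspace_limit_topology by blast
  have inj: "inj_on ?t (topspace S)" using lim homeomorphic_imp_injective_map by blast
  have down: "b i j (\<pi> j x) = \<pi> i x"
    if "x \<in> topspace S" "i \<in> \<Lambda>" "j \<in> \<Lambda>" "prec i j" for x i j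
    using threadsD(2)[of "?t x" \<Lambda> prec Y b i j] im that by fastforce
  have stage: "\<pi> i x \<in> topspace (Y i)" if "x \<in> topspace S" "i \<in> \<Lambda>" for x i
    using threadsD(1)[of "?t x" \<Lambda> prec Y b i] im that by fastforce
  have thr: "?s x \<in> threads ?B prec Y b" if x: "x \<in> topspace S" for x
    unfolding threads_def using x B stage[OF x] down[OF x] by (simp add: subset_iff)
  show "continuous_map S (limit_topology ?B prec Y b) ?s"
  proof (rule continuous_map_into_limit_topology)
    fix i assume i: "i \<in> ?B"
    have "continuous_map S (Y i) (\<lambda>g. ?t g i)"
      using continuous_map_compose[OF homeomorphic_imp_continuous_map[OF lim]
          continuous_map_limit_projection[of i \<Lambda>]] i B by (auto simp: o_def)
    then show "continuous_map S (Y i) (\<lambda>g. ?s g i)" using i B by auto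
  qed (fact thr)
  show "compact_space S" by fact
  show "Hausdorff_space (limit_topology ?B prec Y b)"
    using Haus B by (intro Hausdorff_space_limit_topology) auto
  show "?s ` topspace S = topspace (limit_topology ?B prec Y b)"
  proof
    show "?s ` topspace S \<subseteq> topspace (limit_topology ?B prec Y b)"
      using thr topspace_limit_topology by blast
    show "topspace (limit_topology ?B prec Y b) \<subseteq> ?s ` topspace S"
    proof
      fix y assume "y \<in> topspace (limit_topology ?B prec Y b)"
      then have y: "y \<in> threads ?B prec Y b" by (simp add: topspace_limit_topology)
      obtain z where z: "z \<in> threads \<Lambda> prec Y b" "\<And>i. i \<in> ?B \<Longrightarrow> z i = y i"
        using thread_extension[OF sys \<beta> y] by metis
      then obtain x where x: "x \<in> topspace S" "z = ?t x" using im by blast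
      have "y = ?s x"
      proof
        fix i show "y i = ?s x i"
          using z(2)[of i] x(2) y B by (cases "i \<in> ?B") (auto simp: threads_def PiE_def extensional_def)
      qed
      then show "y \<in> ?s ` topspace S" using x(1) by blast
    qed
  qed
  show "inj_on ?s (topspace S)"
  proof (rule inj_onI)
    fix x x' assume x: "x \<in> topspace S" "x' \<in> topspace S" "?s x = ?s x'"
    have "\<pi> i x = \<pi> i x'" if i: "i \<in> \<Lambda>" for i
    proof -
      obtain j where j: "j \<in> ?B" "prec i j"
        using dir i \<beta> unfolding directed_index_set_def index_above_def by blast
      then have "\<pi> j x = \<pi> j x'" using fun_cong[OF x(3), of j] by simp
      moreover have "j \<in> \<Lambda>" using j B by blast
      ultimately show ?thesis
        using down[OF x(1) i _ j(2)] down[OF x(2) i _ j(2)] by simp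
    qed
    then have "?t x = ?t x'" by (simp add: restrict_def fun_eq_iff)
    then show "x = x'" using inj x by (simp add: inj_on_def)
  qed
qed


section \<open>Slices of a covering\<close>

lemma slice_partitionD:
  assumes "slice_partition k X Y p W V"
  shows "openin Y W"
    and "l \<in> {1..k} \<Longrightarrow> openin X (V l)"
    and "l \<in> {1..k} \<Longrightarrow> p ` V l = W"
    and "l \<in> {1..k} \<Longrightarrow> inj_on p (V l)"
    and "x \<in> topspace X \<Longrightarrow> p x \<in> W \<Longrightarrow> \<exists>l\<in>{1..k}. x \<in> V l"
    and "l \<in> {1..k} \<Longrightarrow> l' \<in> {1..k} \<Longrightarrow> x \<in> V l \<Longrightarrow> x \<in> V l' \<Longrightarrow> l = l'"
proof -
  show W: "openin Y W" using assms by (simp add: slice_partition_def)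
  show "x \<in> topspace X \<Longrightarrow> p x \<in> W \<Longrightarrow> \<exists>l\<in>{1..k}. x \<in> V l"
    using assms unfolding slice_partition_def by blast
  show "l \<in> {1..k} \<Longrightarrow> l' \<in> {1..k} \<Longrightarrow> x \<in> V l \<Longrightarrow> x \<in> V l' \<Longrightarrow> l = l'"
    using assms unfolding slice_partition_def disjoint_family_on_def by blast
  assume l: "l \<in> {1..k}"
  show V: "openin X (V l)" using assms l by (simp add: slice_partition_def)
  have hom: "homeomorphic_map (subtopology X (V l)) (subtopology Y W) p"
    using assms l by (simp add: slice_partition_def)
  show "p ` V l = W"
    using homeomorphic_imp_surjective_map[OF hom] openin_subset[OF V] openin_subset[OF W]
    by (simp add: inf.absorb2)
  show "inj_on p (V l)"
    using homeomorphic_imp_injective_map[OF hom] openin_subset[OF V] by (simp add: inf.absorb2)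
qed

lemma slice_partition_openin_image:
  assumes sp: "slice_partition k X Y p W V" and l: "l \<in> {1..k}"
    and A: "openin X A" "A \<subseteq> V l"
  shows "openin Y (p ` A)"
proof -
  have "open_map (subtopology X (V l)) (subtopology Y W) p"
    using sp l homeomorphic_imp_open_map unfolding slice_partition_def by blast
  moreover have "openin (subtopology X (V l)) A"
    using A slice_partitionD(2)[OF sp l]
    by (simp add: openin_open_subtopology)
  ultimately have "openin (subtopology Y W) (p ` A)" by (simp add: open_map_def)
  then show ?thesis
    using slice_partitionD(1)[OF sp] openin_trans_full by blast
qed

text \<open>The preimage consists of \<open>k\<close> copies of \<open>C\<close>, one in each slice.  Finitely many such sets \<open>C\<close> will
cover the base, which makes the total space compact.\<close>

lemma slice_partition_compact_preimage:
  assumes sp: "slice_partition k X Y p W V" and C: "compactin Y C" "C \<subseteq> W"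
  shows "compactin X {x \<in> topspace X. p x \<in> C}"
proof -
  have "compactin X {x \<in> V l. p x \<in> C}" if l: "l \<in> {1..k}" for l
  proof -
    have hom: "homeomorphic_map (subtopology X (V l)) (subtopology Y W) p"
      using sp l by (simp add: slice_partition_def)
    have V: "V l \<subseteq> topspace X" using slice_partitionD(2)[OF sp l] openin_subset by blast
    have "p ` {x \<in> V l. p x \<in> C} = C"
      using slice_partitionD(3)[OF sp l] C(2) by blast
    moreover have "compactin (subtopology Y W) C" using C by (simp add: compactin_subtopology)
    ultimately have "compactin (subtopology X (V l)) {x \<in> V l. p x \<in> C}"
      using homeomorphic_map_compactness[OF hom, of "{x \<in> V l. p x \<in> C}"] V by auto
    then show ?thesis by (simp add: compactin_subtopology)
  qed
  then have "compactin X (\<Union>l\<in>{1..k}. {x \<in> V l. p x \<in> C})"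
    by (intro compactin_Union) auto
  moreover have "{x \<in> topspace X. p x \<in> C} = (\<Union>l\<in>{1..k}. {x \<in> V l. p x \<in> C})"
  proof -
    have "V l \<subseteq> topspace X" if "l \<in> {1..k}" for l
      using slice_partitionD(2)[OF sp that] openin_subset by blast
    then show ?thesis using slice_partitionD(5)[OF sp] C(2) by fast
  qed
  ultimately show ?thesis by simp
qed

definition sheet_label :: "nat \<Rightarrow> nat \<Rightarrow> complex"
  where "sheet_label k l = exp (\<i> * complex_of_real (2 * pi / real k * (real l - 1)))"

lemma sheet_label_inject:
  assumes "l \<in> {1..k}" "l' \<in> {1..k}" "sheet_label k l = sheet_label k l'"
  shows "l = l'"
proof -
  have eq: "sheet_label k j = exp (2 * of_real pi * \<i> * of_nat (j - 1) / of_nat k)"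
    if "j \<in> {1..k}" for j
    using that unfolding sheet_label_def by (simp add: of_nat_diff field_simps)
  have "(l - 1) mod k = (l' - 1) mod k"
    using assms eq[OF assms(1)] eq[OF assms(2)] complex_root_unity_eq[of k "l - 1" "l' - 1"] by simp
  then show ?thesis using assms by auto
qed


section \<open>Separating sheets by roots of unity\<close>

text \<open>The construction, reduced to its topological content.  The functions \<open>f n\<close> are absorbed into
\<open>fhat n\<close>, which is described on the slices and where the weight vanishes; the sets \<open>U n\<close> are
absorbed into \<open>weight_support\<close>.\<close>

locale sheet_tower =
  fixes X :: "'x topology" and S :: "'g topology" and k :: nat and p :: "'x \<Rightarrow> 'g"
    and \<Lambda> :: "'i set" and prec :: "'i \<Rightarrow> 'i \<Rightarrow> bool"
    and T :: "'i \<Rightarrow> 'h topology" and b :: "'i \<Rightarrow> 'i \<Rightarrow> 'h \<Rightarrow> 'h" and \<pi> :: "'i \<Rightarrow> 'g \<Rightarrow> 'h"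
    and \<alpha> :: 'i and m :: nat
    and W :: "nat \<Rightarrow> 'g set" and V :: "nat \<Rightarrow> nat \<Rightarrow> 'x set" and \<phi> :: "nat \<Rightarrow> 'h \<Rightarrow> real"
    and fhat :: "nat \<Rightarrow> 'x \<Rightarrow> complex" and h :: "'i \<Rightarrow> 'x \<Rightarrow> 'h \<times> (nat \<Rightarrow> complex)"
    and X\<^sub>s :: "'i \<Rightarrow> ('h \<times> (nat \<Rightarrow> complex)) topology"
    and p\<^sub>s :: "'i \<Rightarrow> 'h \<times> (nat \<Rightarrow> complex) \<Rightarrow> 'h"
    and hb :: "'i \<Rightarrow> 'i \<Rightarrow> 'h \<times> (nat \<Rightarrow> complex) \<Rightarrow> 'h \<times> (nat \<Rightarrow> complex)"
  assumes compact_base: "compact_space S"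
    and cover_continuous: "continuous_map X S p"
    and cover_onto: "p ` topspace X = topspace S"
    and system: "inverse_system \<Lambda> prec T b"
    and Hausdorff_stage: "\<And>i. i \<in> \<Lambda> \<Longrightarrow> Hausdorff_space (T i)"
    and limit: "homeomorphic_map S (limit_topology \<Lambda> prec T b) (\<lambda>g. \<lambda>i\<in>\<Lambda>. \<pi> i g)"
    and projection_open: "\<And>i. i \<in> \<Lambda> \<Longrightarrow> open_map S (T i) (\<pi> i)"
    and projection_onto: "\<And>i. i \<in> \<Lambda> \<Longrightarrow> \<pi> i ` topspace S = topspace (T i)"
    and base_index: "\<alpha> \<in> \<Lambda>"
    and slices: "\<And>n. n \<in> {1..m} \<Longrightarrow> slice_partition k X S p (W n) (V n)"
    and weight_continuous: "\<And>n. n \<in> {1..m} \<Longrightarrow> continuous_map (T \<alpha>) euclideanreal (\<phi> n)"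
    and weight_nonneg: "\<And>n y. n \<in> {1..m} \<Longrightarrow> y \<in> topspace (T \<alpha>) \<Longrightarrow> 0 \<le> \<phi> n y"
    and weight_sum: "\<And>y. y \<in> topspace (T \<alpha>) \<Longrightarrow> (\<Sum>n=1..m. \<phi> n y) = 1"
    and weight_support:
      "\<And>n. n \<in> {1..m} \<Longrightarrow> S closure_of {g \<in> topspace S. \<phi> n (\<pi> \<alpha> g) > 0} \<subseteq> W n"
    and fhat_slice: "\<And>n l x. n \<in> {1..m} \<Longrightarrow> l \<in> {1..k} \<Longrightarrow> x \<in> V n l \<Longrightarrow>
      fhat n x = complex_of_real (\<phi> n (\<pi> \<alpha> (p x))) * sheet_label k l"
    and fhat_zero: "\<And>n x. n \<in> {1..m} \<Longrightarrow> x \<in> topspace X \<Longrightarrow> \<phi> n (\<pi> \<alpha> (p x)) = 0 \<Longrightarrow> fhat n x = 0"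
    and h_eq: "\<And>i x. i \<in> index_above \<Lambda> prec \<alpha> \<Longrightarrow> x \<in> topspace X \<Longrightarrow>
      h i x = (\<pi> i (p x), \<lambda>n\<in>{1..m}. fhat n x)"
    and Xs_eq: "\<And>i. i \<in> index_above \<Lambda> prec \<alpha> \<Longrightarrow> X\<^sub>s i = subtopology
      (prod_topology (T i) (product_topology (\<lambda>n. euclidean) {1..m})) (h i ` topspace X)"
    and ps_eq: "\<And>i y. i \<in> index_above \<Lambda> prec \<alpha> \<Longrightarrow> y \<in> topspace (X\<^sub>s i) \<Longrightarrow> p\<^sub>s i y = fst y"
    and hb_eq: "\<And>i j x. i \<in> index_above \<Lambda> prec \<alpha> \<Longrightarrow> j \<in> index_above \<Lambda> prec \<alpha> \<Longrightarrow> prec i j \<Longrightarrow>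
      x \<in> topspace X \<Longrightarrow> hb i j (h j x) = h i x"
begin

abbreviation weight :: "nat \<Rightarrow> 'g \<Rightarrow> real"
  where "weight n g \<equiv> \<phi> n (\<pi> \<alpha> g)"

abbreviation support :: "nat \<Rightarrow> 'g set"
  where "support n \<equiv> S closure_of {g \<in> topspace S. weight n g > 0}"

lemma directed: "directed_index_set \<Lambda> prec"
  using system by (simp add: inverse_system_def)

lemma prec_trans: "i \<in> \<Lambda> \<Longrightarrow> j \<in> \<Lambda> \<Longrightarrow> l \<in> \<Lambda> \<Longrightarrow> prec i j \<Longrightarrow> prec j l \<Longrightarrow> prec i l"
  using directed unfolding directed_index_set_def by blast

lemma projection_thread: "g \<in> topspace S \<Longrightarrow> (\<lambda>i\<in>\<Lambda>. \<pi> i g) \<in> threads \<Lambda> prec T b"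
  using homeomorphic_imp_surjective_map[OF limit] topspace_limit_topology by blast

lemma projection_bond:
  assumes "g \<in> topspace S" "i \<in> \<Lambda>" "j \<in> \<Lambda>" "prec i j"
  shows "b i j (\<pi> j g) = \<pi> i g"
  using threadsD(2)[OF projection_thread] assms by fastforce

lemma projection_continuous:
  assumes "i \<in> \<Lambda>"
  shows "continuous_map S (T i) (\<pi> i)"
  using continuous_map_compose[OF homeomorphic_imp_continuous_map[OF limit]
      continuous_map_limit_projection[OF assms]] assms by (simp add: o_def)

lemma weight_eq_if_projection_eq:
  assumes "j \<in> index_above \<Lambda> prec \<alpha>" "g \<in> topspace S" "g' \<in> topspace S" "\<pi> j g = \<pi> j g'"
  shows "weight n g = weight n g'"
  using projection_bond[of g \<alpha> j] projection_bond[of g' \<alpha> j] base_index assms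
  by (simp add: index_above_def)

lemma continuous_map_weight:
  assumes "n \<in> {1..m}"
  shows "continuous_map S euclideanreal (weight n)"
  using continuous_map_compose[OF projection_continuous[OF base_index] weight_continuous[OF assms]]
  by (simp add: o_def)

lemma cover_in_base: "x \<in> topspace X \<Longrightarrow> p x \<in> topspace S"
  using cover_onto by blast

lemma slice_subset: "n \<in> {1..m} \<Longrightarrow> l \<in> {1..k} \<Longrightarrow> V n l \<subseteq> topspace X"
  using slice_partitionD(2)[OF slices] openin_subset by metis

lemma exists_positive_weight:
  assumes "y \<in> topspace (T \<alpha>)"
  obtains n where "n \<in> {1..m}" "\<phi> n y > 0"
proof -
  have "\<exists>n\<in>{1..m}. \<phi> n y \<noteq> 0"
    using weight_sum[OF assms] by (metis sum.neutral zero_neq_one)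
  then show thesis using that weight_nonneg[OF _ assms] by (metis less_eq_real_def)
qed

lemma projection_in_stage: "i \<in> \<Lambda> \<Longrightarrow> g \<in> topspace S \<Longrightarrow> \<pi> i g \<in> topspace (T i)"
  using projection_onto by blast

lemma positive_weight_in_support:
  assumes "g \<in> topspace S" "weight n g > 0"
  shows "g \<in> support n"
  using closure_of_subset[of "{g \<in> topspace S. weight n g > 0}" S] assms by blast

lemma slice_of_positive_weight:
  assumes "n \<in> {1..m}" "x \<in> topspace X" "weight n (p x) > 0"
  obtains l where "l \<in> {1..k}" "x \<in> V n l"
  using slice_partitionD(5)[OF slices[OF assms(1)] assms(2)] weight_support[OF assms(1)]
    positive_weight_in_support[OF cover_in_base[OF assms(2)] assms(3)] that by blast

text \<open>Dividing by a positive weight leaves a root of unity, which names the slice.\<close>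

lemma fhat_eq_imp_same_slice:
  assumes n: "n \<in> {1..m}" and l: "l \<in> {1..k}" "l' \<in> {1..k}" and x: "x \<in> V n l" "x' \<in> V n l'"
    and w: "weight n (p x) = weight n (p x')" "weight n (p x) > 0" and eq: "fhat n x = fhat n x'"
  shows "l = l'"
  using eq w fhat_slice[OF n l(1) x(1)] fhat_slice[OF n l(2) x(2)] sheet_label_inject[OF l] by simp

lemma compact_total: "compact_space X"
proof -
  have "compactin X {x \<in> topspace X. p x \<in> support n}" if "n \<in> {1..m}" for n
    using slice_partition_compact_preimage[OF slices[OF that] _ weight_support[OF that]]
      compact_base closedin_compact_space closedin_closure_of by blast
  then have "compactin X (\<Union>n\<in>{1..m}. {x \<in> topspace X. p x \<in> support n})"
    by (intro compactin_Union) auto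
  moreover have "(\<Union>n\<in>{1..m}. {x \<in> topspace X. p x \<in> support n}) = topspace X"
  proof -
    have "\<exists>n\<in>{1..m}. p x \<in> support n" if "x \<in> topspace X" for x
      using exists_positive_weight[OF projection_in_stage[OF base_index cover_in_base[OF that]]]
        positive_weight_in_support[OF cover_in_base[OF that]] by blast
    then show ?thesis by blast
  qed
  ultimately show ?thesis by (simp add: compact_space_def)
qed

lemma cover_open: "open_map X S p"
  unfolding open_map_def
proof (intro allI impI)
  fix A assume A: "openin X A"
  have "\<exists>N. openin S N \<and> p x \<in> N \<and> N \<subseteq> p ` A" if x: "x \<in> A" for x
  proof -
    have xX: "x \<in> topspace X" using A x openin_subset by blast
    obtain n where n: "n \<in> {1..m}" "weight n (p x) > 0"
      using exists_positive_weight[OF projection_in_stage[OF base_index cover_in_base[OF xX]]] .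
    obtain l where l: "l \<in> {1..k}" "x \<in> V n l"
      using slice_of_positive_weight[OF n(1) xX n(2)] .
    have "openin S (p ` (A \<inter> V n l))"
      using slice_partition_openin_image[OF slices[OF n(1)] l(1)] A
        slice_partitionD(2)[OF slices[OF n(1)] l(1)] by blast
    then show ?thesis using x l by blast
  qed
  then show "openin S (p ` A)" by (subst openin_subopen) blast
qed

text \<open>On a slice \<open>fhat n\<close> is the weight times a constant, and off the preimage of the support it is zero.
Because the support is closed and contained in \<open>W n\<close>, these regions form an open cover.\<close>

lemma continuous_map_fhat:
  assumes n: "n \<in> {1..m}"
  shows "continuous_map X euclidean (fhat n)"
proof -
  have wc: "continuous_map X euclideanreal (\<lambda>x. weight n (p x))"
    using continuous_map_compose[OF cover_continuous continuous_map_weight[OF n]] by (simp add: o_def)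
  \<comment> \<open>Index \<open>0\<close> stands for the region off the support, the others for the slices.\<close>
  let ?D = "\<lambda>l. if l = 0 then {x \<in> topspace X. p x \<in> topspace S - support n} else V n l"
  let ?f = "\<lambda>l x. if l = 0 then 0 else complex_of_real (weight n (p x)) * sheet_label k l"
  have off: "weight n (p x) = 0" if "x \<in> topspace X" "p x \<notin> support n" for x
    using positive_weight_in_support[of "p x" n] that weight_nonneg[OF n] cover_in_base
      projection_in_stage[OF base_index] by (metis less_eq_real_def)
  show ?thesis
  proof (rule pasting_lemma[where I = "{0..k}" and T = ?D and f = ?f])
    fix l assume l: "l \<in> {0..k}"
    show "openin X (?D l)"
    proof (cases "l = 0")
      case True
      have "openin S (topspace S - support n)" by auto
      from openin_continuous_map_preimage[OF cover_continuous this] show ?thesis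
        using True by simp
    qed (use slice_partitionD(2)[OF slices[OF n], of l] l in simp)
    have "continuous_map X euclidean (\<lambda>x. complex_of_real (weight n (p x)) * sheet_label k l)"
      using continuous_map_compose[OF wc, of euclidean "\<lambda>t. complex_of_real t * sheet_label k l"]
      by (simp add: o_def continuous_intros)
    then show "continuous_map (subtopology X (?D l)) euclidean (?f l)"
      by (cases "l = 0") (auto intro: continuous_map_from_subtopology)
  next
    fix l l' x assume *: "l \<in> {0..k}" "l' \<in> {0..k}" "x \<in> topspace X \<inter> ?D l \<inter> ?D l'"
    show "?f l x = ?f l' x"
      using * off[of x] slice_partitionD(6)[OF slices[OF n], of l l' x]
      by (auto split: if_splits)
  next
    fix x assume x: "x \<in> topspace X"
    show "\<exists>l. l \<in> {0..k} \<and> x \<in> ?D l \<and> fhat n x = ?f l x"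
    proof (cases "p x \<in> support n")
      case True
      then obtain l where l: "l \<in> {1..k}" "x \<in> V n l"
        using slice_partitionD(5)[OF slices[OF n] x] weight_support[OF n] by blast
      then show ?thesis using fhat_slice[OF n l] by (intro exI[of _ l]) auto
    next
      case False
      then show ?thesis using fhat_zero[OF n x off[OF x]] x cover_in_base[OF x]
        by (intro exI[of _ 0]) auto
    qed
  qed
qed

text \<open>The key step.  For fixed \<open>n\<close>, \<open>n'\<close> and \<open>l\<close>, the sets \<open>p ` (V n l \<inter> V n' l')\<close> cover the intersection
of the two supports, so late fibres of the projections that meet this intersection are contained
in one of them.  As \<open>p\<close> is
injective on \<open>V n l\<close>, the part of \<open>V n l\<close> over such a fibre stays in a single slice \<open>V n' l'\<close>, and
\<open>fhat n'\<close> takes only one value there.\<close>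

lemma fhat_determined_by_slice:
  obtains \<beta> where "\<beta> \<in> index_above \<Lambda> prec \<alpha>"
    "\<And>j x x' n n'. j \<in> index_above \<Lambda> prec \<beta> \<Longrightarrow> x \<in> topspace X \<Longrightarrow> x' \<in> topspace X \<Longrightarrow>
       \<pi> j (p x) = \<pi> j (p x') \<Longrightarrow> n \<in> {1..m} \<Longrightarrow> n' \<in> {1..m} \<Longrightarrow> weight n (p x) > 0 \<Longrightarrow>
       fhat n x = fhat n x' \<Longrightarrow> fhat n' x = fhat n' x'"
proof -
  let ?I = "{1..m} \<times> {1..m} \<times> {1..k}"
  have "\<exists>u\<in>\<Lambda>. \<forall>i\<in>\<Lambda>. prec u i \<longrightarrow> (\<forall>g\<in>support n \<inter> support n'. \<exists>l'\<in>{1..k}.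
          \<forall>g'\<in>topspace S. \<pi> i g' = \<pi> i g \<longrightarrow> g' \<in> p ` (V n l \<inter> V n' l'))"
    if n: "n \<in> {1..m}" "n' \<in> {1..m}" "l \<in> {1..k}" for n n' l
  proof -
    let ?A = "(\<lambda>l'. p ` (V n l \<inter> V n' l')) ` {1..k}"
    have C: "compactin S (support n \<inter> support n')"
      using compact_base by (intro closedin_compact_space) auto
    have op: "openin S A" if "A \<in> ?A" for A
      using that slice_partition_openin_image[OF slices[OF n(1)] n(3)]
        slice_partitionD(2)[OF slices[OF n(1)] n(3)] slice_partitionD(2)[OF slices[OF n(2)]] by blast
    have cov: "support n \<inter> support n' \<subseteq> \<Union>?A"
    proof
      fix g assume g: "g \<in> support n \<inter> support n'"
      then have "g \<in> W n" "g \<in> W n'" using weight_support n by blast+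
      then obtain x where x: "x \<in> V n l" "g = p x"
        using slice_partitionD(3)[OF slices[OF n(1)] n(3)] by blast
      then obtain l' where "l' \<in> {1..k}" "x \<in> V n' l'"
        using slice_partitionD(5)[OF slices[OF n(2)], of x] \<open>g \<in> W n'\<close> slice_subset[OF n(1,3)] by blast
      then show "g \<in> \<Union>?A" using x by blast
    qed
    show ?thesis
      using fibres_refine_open_cover[OF system limit C op cov] unfolding bex_simps(7) .
  qed
  then have "\<forall>t\<in>?I. \<exists>u\<in>\<Lambda>. \<forall>i\<in>\<Lambda>. prec u i \<longrightarrow>
      (\<forall>g\<in>support (fst t) \<inter> support (fst (snd t)). \<exists>l'\<in>{1..k}. \<forall>g'\<in>topspace S.
         \<pi> i g' = \<pi> i g \<longrightarrow> g' \<in> p ` (V (fst t) (snd (snd t)) \<inter> V (fst (snd t)) l'))"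
    by auto
  then obtain u where u: "\<And>t. t \<in> ?I \<Longrightarrow> u t \<in> \<Lambda>"
    and u': "\<And>n n' l i g. n \<in> {1..m} \<Longrightarrow> n' \<in> {1..m} \<Longrightarrow> l \<in> {1..k} \<Longrightarrow> i \<in> \<Lambda> \<Longrightarrow>
      prec (u (n, n', l)) i \<Longrightarrow> g \<in> support n \<Longrightarrow> g \<in> support n' \<Longrightarrow>
      \<exists>l'\<in>{1..k}. \<forall>g'\<in>topspace S. \<pi> i g' = \<pi> i g \<longrightarrow> g' \<in> p ` (V n l \<inter> V n' l')"
    unfolding Bex_def by (subst (asm) bchoice_iff) force
  obtain \<beta> where \<beta>: "\<beta> \<in> \<Lambda>" "\<forall>i\<in>insert \<alpha> (u ` ?I). prec i \<beta>"
    using directed_index_set_finite_upper_bound[OF directed, of "insert \<alpha> (u ` ?I)"] u base_index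
    by auto
  show thesis
  proof
    show "\<beta> \<in> index_above \<Lambda> prec \<alpha>" using \<beta> by (simp add: index_above_def)
    fix j x x' n n'
    assume j: "j \<in> index_above \<Lambda> prec \<beta>" and x: "x \<in> topspace X" "x' \<in> topspace X"
      and eq: "\<pi> j (p x) = \<pi> j (p x')" and n: "n \<in> {1..m}" and n': "n' \<in> {1..m}"
      and pos: "weight n (p x) > 0" and fh: "fhat n x = fhat n x'"
    have jL: "j \<in> \<Lambda>" "prec \<beta> j" using j by (auto simp: index_above_def)
    have j\<alpha>: "j \<in> index_above \<Lambda> prec \<alpha>"
      using prec_trans[OF base_index \<beta>(1) jL(1) _ jL(2)] \<beta>(2) jL by (simp add: index_above_def)
    have w: "weight q (p x) = weight q (p x')" for q
      using weight_eq_if_projection_eq[OF j\<alpha> cover_in_base[OF x(1)] cover_in_base[OF x(2)] eq] .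
    obtain l where l: "l \<in> {1..k}" "x \<in> V n l" using slice_of_positive_weight[OF n x(1) pos] .
    obtain l1 where l1: "l1 \<in> {1..k}" "x' \<in> V n l1"
      using slice_of_positive_weight[OF n x(2)] pos w by metis
    have "l1 = l" using fhat_eq_imp_same_slice[OF n l(1) l1(1) l(2) l1(2) w pos fh] by simp
    then have x'l: "x' \<in> V n l" using l1 by simp
    \<comment> \<open>If the weight of index \<open>n'\<close> is zero, so are both values; otherwise \<open>p x\<close> lies in both supports.\<close>
    show "fhat n' x = fhat n' x'"
    proof (cases "weight n' (p x) > 0")
      case False
      then have "weight n' (p x) = 0"
        using weight_nonneg[OF n' projection_in_stage[OF base_index cover_in_base[OF x(1)]]]
        by linarith
      then show ?thesis using fhat_zero[OF n' x(1)] fhat_zero[OF n' x(2)] w by simp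
    next
      case True
      have t: "(n, n', l) \<in> ?I" using n n' l by simp
      have "prec (u (n, n', l)) j"
        using prec_trans[OF u[OF t] \<beta>(1) jL(1) _ jL(2)] \<beta>(2) t by blast
      then obtain l' where l': "l' \<in> {1..k}"
        "\<And>g'. g' \<in> topspace S \<Longrightarrow> \<pi> j g' = \<pi> j (p x) \<Longrightarrow> g' \<in> p ` (V n l \<inter> V n' l')"
        using u'[OF n n' l(1) jL(1) _ positive_weight_in_support[OF cover_in_base[OF x(1)] pos]
            positive_weight_in_support[OF cover_in_base[OF x(1)] True]] by blast
      have in_l': "z \<in> V n' l'" if z: "z \<in> V n l" "\<pi> j (p z) = \<pi> j (p x)" for z
      proof -
        have "p z \<in> p ` (V n l \<inter> V n' l')"
          using l'(2)[OF cover_in_base] z slice_subset[OF n l(1)] by blast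
        then show ?thesis
          using slice_partitionD(4)[OF slices[OF n] l(1)] z(1) by (auto dest: inj_onD)
      qed
      show ?thesis
        using fhat_slice[OF n' l'(1) in_l'[OF l(2) refl]] fhat_slice[OF n' l'(1) in_l'[OF x'l eq[symmetric]]] w
        by simp
    qed
  qed
qed


subsection \<open>The stages as coverings\<close>

lemma above_index:
  assumes "i \<in> index_above \<Lambda> prec \<alpha>"
  shows "i \<in> \<Lambda>"
  using assms by (simp add: index_above_def)

lemma above_trans:
  assumes "\<beta> \<in> index_above \<Lambda> prec \<alpha>" "i \<in> index_above \<Lambda> prec \<beta>"
  shows "i \<in> index_above \<Lambda> prec \<alpha>"
  using assms prec_trans[OF base_index, of \<beta> i] unfolding index_above_def by blast

lemma h_continuous_ambient:
  assumes i: "i \<in> index_above \<Lambda> prec \<alpha>"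
  shows "continuous_map X (prod_topology (T i) (product_topology (\<lambda>n. euclidean) {1..m})) (h i)"
proof -
  have "continuous_map X (prod_topology (T i) (product_topology (\<lambda>n. euclidean) {1..m}))
      (\<lambda>x. (\<pi> i (p x), \<lambda>n\<in>{1..m}. fhat n x))"
    using continuous_map_compose[OF cover_continuous projection_continuous[OF above_index[OF i]]]
      continuous_map_fhat
    by (auto simp: continuous_map_pairwise continuous_map_componentwise o_def)
  then show ?thesis
    by (rule continuous_map_eq) (simp add: h_eq[OF i])
qed

lemma topspace_stage:
  assumes i: "i \<in> index_above \<Lambda> prec \<alpha>"
  shows "topspace (X\<^sub>s i) = h i ` topspace X"
  using continuous_map_image_subset_topspace[OF h_continuous_ambient[OF i]]
  unfolding Xs_eq[OF i] topspace_subtopology by blast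

lemma h_continuous:
  assumes i: "i \<in> index_above \<Lambda> prec \<alpha>"
  shows "continuous_map X (X\<^sub>s i) (h i)"
  unfolding Xs_eq[OF i] continuous_map_in_subtopology
  using h_continuous_ambient[OF i] by blast

lemma Hausdorff_total_stage:
  assumes i: "i \<in> index_above \<Lambda> prec \<alpha>"
  shows "Hausdorff_space (X\<^sub>s i)"
  unfolding Xs_eq[OF i]
  using Hausdorff_stage[OF above_index[OF i]]
  by (intro Hausdorff_space_subtopology)
    (simp add: Hausdorff_space_prod_topology Hausdorff_space_product_topology)

lemma compact_total_stage:
  assumes i: "i \<in> index_above \<Lambda> prec \<alpha>"
  shows "compact_space (X\<^sub>s i)"
  using image_compactin[OF _ h_continuous[OF i], of "topspace X"] compact_total topspace_stage[OF i]
  by (simp add: compact_space_def)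

lemma h_quotient:
  assumes i: "i \<in> index_above \<Lambda> prec \<alpha>"
  shows "quotient_map X (X\<^sub>s i) (h i)"
  using continuous_imp_quotient_map[OF h_continuous[OF i] compact_total Hausdorff_total_stage[OF i]]
    topspace_stage[OF i] by simp

lemma stage_map_h:
  assumes i: "i \<in> index_above \<Lambda> prec \<alpha>" and x: "x \<in> topspace X"
  shows "p\<^sub>s i (h i x) = \<pi> i (p x)"
proof -
  have "h i x \<in> topspace (X\<^sub>s i)" using topspace_stage[OF i] x by blast
  then show ?thesis using ps_eq[OF i] h_eq[OF i x] by simp
qed

lemma h_eq_iff:
  assumes i: "i \<in> index_above \<Lambda> prec \<alpha>" and x: "x \<in> topspace X" "x' \<in> topspace X"
  shows "h i x = h i x' \<longleftrightarrow> \<pi> i (p x) = \<pi> i (p x') \<and> (\<forall>n\<in>{1..m}. fhat n x = fhat n x')"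
  unfolding h_eq[OF i x(1)] h_eq[OF i x(2)] by (auto simp: fun_eq_iff restrict_def)

lemma stage_map_continuous:
  assumes i: "i \<in> index_above \<Lambda> prec \<alpha>"
  shows "continuous_map (X\<^sub>s i) (T i) (p\<^sub>s i)"
proof -
  have "continuous_map X (T i) (p\<^sub>s i \<circ> h i)"
    using continuous_map_compose[OF cover_continuous projection_continuous[OF above_index[OF i]]]
    by (rule continuous_map_eq) (simp add: stage_map_h[OF i])
  then show ?thesis using continuous_compose_quotient_map[OF h_quotient[OF i]] by blast
qed

lemma stage_map_onto:
  assumes i: "i \<in> index_above \<Lambda> prec \<alpha>"
  shows "p\<^sub>s i ` topspace (X\<^sub>s i) = topspace (T i)"
proof -
  have "p\<^sub>s i ` topspace (X\<^sub>s i) = \<pi> i ` p ` topspace X"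
    unfolding topspace_stage[OF i] image_image using stage_map_h[OF i] by simp
  then show ?thesis using cover_onto projection_onto[OF above_index[OF i]] by simp
qed

text \<open>Openness descends from \<open>\<pi> i \<circ> p\<close> along the surjection \<open>h i\<close>.\<close>

lemma stage_map_open:
  assumes i: "i \<in> index_above \<Lambda> prec \<alpha>"
  shows "open_map (X\<^sub>s i) (T i) (p\<^sub>s i)"
  unfolding open_map_def
proof (intro allI impI)
  fix A assume A: "openin (X\<^sub>s i) A"
  let ?B = "{x \<in> topspace X. h i x \<in> A}"
  have "openin X ?B" using openin_continuous_map_preimage[OF h_continuous[OF i] A] .
  then have "openin (T i) (\<pi> i ` p ` ?B)"
    using cover_open projection_open[OF above_index[OF i]] unfolding open_map_def by blast
  moreover have "p\<^sub>s i ` A = \<pi> i ` p ` ?B"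
  proof -
    have "A = h i ` ?B" using openin_subset[OF A] unfolding topspace_stage[OF i] by auto
    then have "p\<^sub>s i ` A = p\<^sub>s i ` (h i ` ?B)" by (rule arg_cong)
    also have "\<dots> = (\<lambda>x. p\<^sub>s i (h i x)) ` ?B" by (rule image_image)
    also have "\<dots> = (\<lambda>x. \<pi> i (p x)) ` ?B" by (rule image_cong) (simp_all add: stage_map_h[OF i])
    finally show ?thesis by (simp add: image_image)
  qed
  ultimately show "openin (T i) (p\<^sub>s i ` A)" by simp
qed

text \<open>From a separating index on, \<open>h i x\<close> is determined by \<open>\<pi> i (p x)\<close> and one value \<open>fhat n x\<close> of positive
weight, so each fibre of \<open>p\<^sub>s i\<close> has at most \<open>k\<close> points.\<close>

definition separating :: "'i \<Rightarrow> bool"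
  where "separating \<beta> \<longleftrightarrow> \<beta> \<in> index_above \<Lambda> prec \<alpha> \<and>
    (\<forall>i\<in>index_above \<Lambda> prec \<beta>. \<forall>x\<in>topspace X. \<forall>x'\<in>topspace X. \<forall>n\<in>{1..m}.
       \<pi> i (p x) = \<pi> i (p x') \<longrightarrow> weight n (p x) > 0 \<longrightarrow> fhat n x = fhat n x' \<longrightarrow> h i x = h i x')"

lemma exists_separating: "\<exists>\<beta>. separating \<beta>"
proof (rule fhat_determined_by_slice)
  fix \<beta> assume \<beta>: "\<beta> \<in> index_above \<Lambda> prec \<alpha>"
    "\<And>j x x' n n'. j \<in> index_above \<Lambda> prec \<beta> \<Longrightarrow> x \<in> topspace X \<Longrightarrow> x' \<in> topspace X \<Longrightarrow>
       \<pi> j (p x) = \<pi> j (p x') \<Longrightarrow> n \<in> {1..m} \<Longrightarrow> n' \<in> {1..m} \<Longrightarrow> weight n (p x) > 0 \<Longrightarrow>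
       fhat n x = fhat n x' \<Longrightarrow> fhat n' x = fhat n' x'"
  have "h i x = h i x'" if "i \<in> index_above \<Lambda> prec \<beta>" "x \<in> topspace X" "x' \<in> topspace X"
    "n \<in> {1..m}" "\<pi> i (p x) = \<pi> i (p x')" "weight n (p x) > 0" "fhat n x = fhat n x'" for i x x' n
    using \<beta>(2)[OF that(1,2,3,5,4) _ that(6,7)] h_eq_iff[OF above_trans[OF \<beta>(1) that(1)] that(2,3)]
      that(5) by blast
  then show ?thesis using \<beta>(1) unfolding separating_def by blast
qed

lemma h_eq_if_same_slice:
  assumes \<beta>: "separating \<beta>" and i: "i \<in> index_above \<Lambda> prec \<beta>"
    and n: "n \<in> {1..m}" and l: "l \<in> {1..k}" and x: "x \<in> V n l" "x' \<in> V n l"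
    and eq: "\<pi> i (p x) = \<pi> i (p x')" and pos: "weight n (p x) > 0"
  shows "h i x = h i x'"
proof -
  have x': "x \<in> topspace X" "x' \<in> topspace X" using x slice_subset[OF n l] by blast+
  have "i \<in> index_above \<Lambda> prec \<alpha>" using above_trans \<beta> i unfolding separating_def by blast
  then have "weight n (p x) = weight n (p x')"
    using weight_eq_if_projection_eq[OF _ cover_in_base[OF x'(1)] cover_in_base[OF x'(2)] eq] by blast
  then have "fhat n x = fhat n x'" using fhat_slice[OF n l x(1)] fhat_slice[OF n l x(2)] by simp
  then show ?thesis using \<beta> i n eq pos x' unfolding separating_def by blast
qed

lemma same_slice_if_h_eq:
  assumes i: "i \<in> index_above \<Lambda> prec \<alpha>" and n: "n \<in> {1..m}" and l: "l \<in> {1..k}"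
    and x: "x \<in> V n l" "x' \<in> topspace X" and eq: "h i x = h i x'" and pos: "weight n (p x) > 0"
  shows "x' \<in> V n l"
proof -
  have xX: "x \<in> topspace X" using x slice_subset[OF n l] by blast
  have e: "\<pi> i (p x) = \<pi> i (p x')" "fhat n x = fhat n x'"
    using eq n h_eq_iff[OF i xX x(2)] by blast+
  have w: "weight n (p x) = weight n (p x')"
    using weight_eq_if_projection_eq[OF i cover_in_base[OF xX] cover_in_base[OF x(2)] e(1)] .
  obtain l' where l': "l' \<in> {1..k}" "x' \<in> V n l'"
    using slice_of_positive_weight[OF n x(2)] pos w by metis
  then show ?thesis using fhat_eq_imp_same_slice[OF n l l'(1) x(1) l'(2) w pos e(2)] by simp
qed

text \<open>The set where a weight is positive is evenly covered; its sheets are the images of the slices of \<open>p\<close>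
under \<open>h i\<close>.  Their \<open>h i\<close>-saturation gives disjointness and, as \<open>h i\<close> is a quotient map, openness;
separation gives injectivity of \<open>p\<^sub>s i\<close> on each of them.\<close>

lemma stage_covering:
  assumes \<beta>: "separating \<beta>" and i\<beta>: "i \<in> index_above \<Lambda> prec \<beta>"
  shows "k_fold_covering k (X\<^sub>s i) (T i) (p\<^sub>s i)"
  unfolding k_fold_covering_def
proof (intro conjI ballI)
  have i: "i \<in> index_above \<Lambda> prec \<alpha>" using above_trans \<beta> i\<beta> unfolding separating_def by blast
  have iL: "i \<in> \<Lambda>" "prec \<alpha> i" using i by (auto simp: index_above_def)
  show "continuous_map (X\<^sub>s i) (T i) (p\<^sub>s i)" by (rule stage_map_continuous[OF i])
  show "p\<^sub>s i ` topspace (X\<^sub>s i) = topspace (T i)" by (rule stage_map_onto[OF i])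
  fix y assume y: "y \<in> topspace (T i)"
  have bc: "continuous_map (T i) (T \<alpha>) (b \<alpha> i)"
    using system base_index iL unfolding inverse_system_def by blast
  obtain n where n: "n \<in> {1..m}" "\<phi> n (b \<alpha> i y) > 0"
    using exists_positive_weight[of "b \<alpha> i y"] continuous_map_image_subset_topspace[OF bc] y by blast
  define Q where "Q = {y \<in> topspace (T i). \<phi> n (b \<alpha> i y) > 0}"
  define R where "R l = h i ` {x \<in> V n l. \<pi> i (p x) \<in> Q}" for l
  have Qopen: "openin (T i) Q"
    using openin_continuous_map_preimage[OF continuous_map_compose[OF bc weight_continuous[OF n(1)]],
        of "{0<..}"] by (simp add: Q_def)
  have in_Q: "\<pi> i g \<in> Q \<longleftrightarrow> weight n g > 0" if "g \<in> topspace S" for g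
    using projection_bond[OF that base_index iL] projection_in_stage[OF iL(1) that]
    by (simp add: Q_def)
  have VX: "x \<in> topspace X" if "l \<in> {1..k}" "x \<in> V n l" for l x
    using slice_subset[OF n(1) that(1)] that(2) by blast
  have R_saturated: "{x \<in> topspace X. h i x \<in> R l} = {x \<in> topspace X. \<pi> i (p x) \<in> Q} \<inter> V n l"
    if l: "l \<in> {1..k}" for l
  proof
    show "{x \<in> topspace X. \<pi> i (p x) \<in> Q} \<inter> V n l \<subseteq> {x \<in> topspace X. h i x \<in> R l}"
      by (auto simp: R_def)
    show "{x \<in> topspace X. h i x \<in> R l} \<subseteq> {x \<in> topspace X. \<pi> i (p x) \<in> Q} \<inter> V n l"
    proof (intro subsetI, elim CollectE conjE)
      fix x assume x: "x \<in> topspace X" "h i x \<in> R l"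
      obtain z where "h i x = h i z" "z \<in> {x \<in> V n l. \<pi> i (p x) \<in> Q}"
        using x(2) unfolding R_def by (rule imageE) (rule that)
      then have z: "z \<in> V n l" "\<pi> i (p z) \<in> Q" "h i z = h i x" by simp_all
      have "x \<in> V n l"
        using same_slice_if_h_eq[OF i n(1) l z(1) x(1) z(3)] in_Q[OF cover_in_base[OF VX[OF l z(1)]]] z(2)
        by blast
      moreover have "\<pi> i (p x) \<in> Q" using h_eq_iff[OF i VX[OF l z(1)] x(1)] z by simp
      ultimately show "x \<in> {x \<in> topspace X. \<pi> i (p x) \<in> Q} \<inter> V n l" using x by blast
    qed
  qed
  have Rsub: "R l \<subseteq> topspace (X\<^sub>s i)" if "l \<in> {1..k}" for l
    using VX[OF that] topspace_stage[OF i] by (auto simp: R_def)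
  have pc: "continuous_map X (T i) (\<lambda>x. \<pi> i (p x))"
    using continuous_map_compose[OF cover_continuous projection_continuous[OF iL(1)]] by (simp add: o_def)
  have Ropen: "openin (X\<^sub>s i) (R l)" if l: "l \<in> {1..k}" for l
  proof -
    have "openin X {x \<in> topspace X. h i x \<in> R l}"
      unfolding R_saturated[OF l]
      using openin_continuous_map_preimage[OF pc Qopen] slice_partitionD(2)[OF slices[OF n(1)] l]
      by (rule openin_Int)
    then show ?thesis using h_quotient[OF i] Rsub[OF l] unfolding quotient_map_def by blast
  qed
  have Rimage: "p\<^sub>s i ` R l = Q" if l: "l \<in> {1..k}" for l
  proof
    show "p\<^sub>s i ` R l \<subseteq> Q" using stage_map_h[OF i] VX[OF l] by (auto simp: R_def)
    show "Q \<subseteq> p\<^sub>s i ` R l"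
    proof
      fix q assume q: "q \<in> Q"
      then obtain g where g: "g \<in> topspace S" "q = \<pi> i g"
        using projection_onto[OF iL(1)] unfolding Q_def by blast
      then have "g \<in> W n"
        using in_Q q positive_weight_in_support weight_support[OF n(1)] by blast
      then have "g \<in> p ` V n l" using slice_partitionD(3)[OF slices[OF n(1)] l] by simp
      then obtain x where x: "x \<in> V n l" "p x = g" by blast
      then have "h i x \<in> R l" using q g by (auto simp: R_def)
      moreover have "p\<^sub>s i (h i x) = q" using stage_map_h[OF i VX[OF l x(1)]] x g by simp
      ultimately show "q \<in> p\<^sub>s i ` R l" by blast
    qed
  qed
  have Rinj: "inj_on (p\<^sub>s i) (R l)" if l: "l \<in> {1..k}" for l
  proof (rule inj_onI)
    fix z z' assume "z \<in> R l" "z' \<in> R l" and eq: "p\<^sub>s i z = p\<^sub>s i z'"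
    then obtain x x' where x: "x \<in> V n l" "z = h i x" "\<pi> i (p x) \<in> Q" and x': "x' \<in> V n l" "z' = h i x'"
      unfolding R_def by blast
    have "\<pi> i (p x) = \<pi> i (p x')"
      using eq stage_map_h[OF i VX[OF l x(1)]] stage_map_h[OF i VX[OF l x'(1)]] x x' by simp
    then show "z = z'"
      using h_eq_if_same_slice[OF \<beta> i\<beta> n(1) l x(1) x'(1)] in_Q[OF cover_in_base[OF VX[OF l x(1)]]] x x'
      by blast
  qed
  have "slice_partition k (X\<^sub>s i) (T i) (p\<^sub>s i) Q R"
    unfolding slice_partition_def
  proof (intro conjI ballI)
    show "openin (T i) Q" by fact
    show "disjoint_family_on R {1..k}"
      unfolding disjoint_family_on_def
    proof (intro ballI impI)
      fix l l' assume l: "l \<in> {1..k}" "l' \<in> {1..k}" "l \<noteq> l'"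
      show "R l \<inter> R l' = {}"
      proof (rule ccontr)
        assume "R l \<inter> R l' \<noteq> {}"
        then obtain x where "x \<in> V n l" "h i x \<in> R l'" unfolding R_def by blast
        then have "x \<in> V n l" "x \<in> V n l'" using R_saturated[OF l(2)] VX[OF l(1)] by blast+
        then show False using slice_partitionD(6)[OF slices[OF n(1)] l(1,2)] l(3) by blast
      qed
    qed
    show "(\<Union>l\<in>{1..k}. R l) = {z \<in> topspace (X\<^sub>s i). p\<^sub>s i z \<in> Q}"
    proof
      show "(\<Union>l\<in>{1..k}. R l) \<subseteq> {z \<in> topspace (X\<^sub>s i). p\<^sub>s i z \<in> Q}"
        using Rsub Rimage by blast
      show "{z \<in> topspace (X\<^sub>s i). p\<^sub>s i z \<in> Q} \<subseteq> (\<Union>l\<in>{1..k}. R l)"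
      proof (intro subsetI, elim CollectE conjE)
        fix z assume "z \<in> topspace (X\<^sub>s i)" "p\<^sub>s i z \<in> Q"
        then obtain x where x: "x \<in> topspace X" "z = h i x" "\<pi> i (p x) \<in> Q"
          using topspace_stage[OF i] stage_map_h[OF i] by auto
        then obtain l where "l \<in> {1..k}" "x \<in> V n l"
          using slice_of_positive_weight[OF n(1) x(1)] in_Q[OF cover_in_base[OF x(1)]] by blast
        then show "z \<in> (\<Union>l\<in>{1..k}. R l)" using x unfolding R_def by blast
      qed
    qed
    fix l assume l: "l \<in> {1..k}"
    show "openin (X\<^sub>s i) (R l)" by (rule Ropen[OF l])
    have top: "topspace (subtopology (X\<^sub>s i) (R l)) = R l" "topspace (subtopology (T i) Q) = Q"
      using Rsub[OF l] openin_subset[OF Qopen] by auto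
    show "homeomorphic_map (subtopology (X\<^sub>s i) (R l)) (subtopology (T i) Q) (p\<^sub>s i)"
    proof (rule bijective_open_imp_homeomorphic_map)
      show "continuous_map (subtopology (X\<^sub>s i) (R l)) (subtopology (T i) Q) (p\<^sub>s i)"
        using continuous_map_from_subtopology[OF stage_map_continuous[OF i]] Rimage[OF l]
        by (auto simp: continuous_map_in_subtopology)
      show "open_map (subtopology (X\<^sub>s i) (R l)) (subtopology (T i) Q) (p\<^sub>s i)"
        unfolding open_map_def
      proof (intro allI impI)
        fix A assume "openin (subtopology (X\<^sub>s i) (R l)) A"
        then have A: "openin (X\<^sub>s i) A" "A \<subseteq> R l" using Ropen[OF l] by (auto simp: openin_open_subtopology)
        then have "openin (T i) (p\<^sub>s i ` A)" using stage_map_open[OF i] unfolding open_map_def by blast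
        moreover have "p\<^sub>s i ` A \<subseteq> Q" using A(2) Rimage[OF l] by blast
        ultimately show "openin (subtopology (T i) Q) (p\<^sub>s i ` A)"
          using Qopen by (simp add: openin_open_subtopology)
      qed
      show "p\<^sub>s i ` topspace (subtopology (X\<^sub>s i) (R l)) = topspace (subtopology (T i) Q)"
        unfolding top by (rule Rimage[OF l])
      show "inj_on (p\<^sub>s i) (topspace (subtopology (X\<^sub>s i) (R l)))"
        unfolding top by (rule Rinj[OF l])
    qed
  qed
  moreover have "y \<in> Q" using y n(2) by (simp add: Q_def)
  ultimately show "\<exists>Q. y \<in> Q \<and> evenly_covered k (X\<^sub>s i) (T i) (p\<^sub>s i) Q"
    unfolding evenly_covered_def by blast
qed


subsection \<open>The limit of the stages\<close>

lemma total_system: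
  assumes \<beta>: "\<beta> \<in> index_above \<Lambda> prec \<alpha>"
  shows "inverse_system (index_above \<Lambda> prec \<beta>) prec X\<^sub>s hb"
  unfolding inverse_system_def
proof (intro conjI ballI impI)
  note above = above_trans[OF \<beta>]
  show "directed_index_set (index_above \<Lambda> prec \<beta>) prec"
    using directed_index_above[OF directed above_index[OF \<beta>]] .
  fix i assume i: "i \<in> index_above \<Lambda> prec \<beta>"
  have refl: "prec i i" using directed above_index[OF above[OF i]] unfolding directed_index_set_def by blast
  show "hb i i z = z" if "z \<in> topspace (X\<^sub>s i)" for z
    using that hb_eq[OF above[OF i] above[OF i] refl] topspace_stage[OF above[OF i]] by auto
  fix j assume j: "j \<in> index_above \<Lambda> prec \<beta>" and ij: "prec i j"
  show "continuous_map (X\<^sub>s j) (X\<^sub>s i) (hb i j)"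
  proof -
    have "continuous_map X (X\<^sub>s i) (hb i j \<circ> h j)"
      using h_continuous[OF above[OF i]]
      by (rule continuous_map_eq) (simp add: hb_eq[OF above[OF i] above[OF j] ij])
    then show ?thesis using continuous_compose_quotient_map[OF h_quotient[OF above[OF j]]] by blast
  qed
  fix l z assume l: "l \<in> index_above \<Lambda> prec \<beta>" and jl: "prec j l" and "z \<in> topspace (X\<^sub>s l)"
  then obtain x where x: "x \<in> topspace X" "z = h l x" using topspace_stage[OF above[OF l]] by auto
  have "prec i l" using prec_trans[OF above_index[OF above[OF i]] above_index[OF above[OF j]]
        above_index[OF above[OF l]] ij jl] .
  then show "hb i l z = hb i j (hb j l z)"
    using x hb_eq[OF above[OF i] above[OF l]] hb_eq[OF above[OF j] above[OF l] jl]
      hb_eq[OF above[OF i] above[OF j] ij] by simp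
qed

lemma stage_morphism:
  assumes \<beta>: "\<beta> \<in> index_above \<Lambda> prec \<alpha>"
  shows "system_morphism (index_above \<Lambda> prec \<beta>) prec X\<^sub>s hb T b p\<^sub>s"
  unfolding system_morphism_def
proof (intro conjI ballI impI)
  note above = above_trans[OF \<beta>]
  fix i assume i: "i \<in> index_above \<Lambda> prec \<beta>"
  show "continuous_map (X\<^sub>s i) (T i) (p\<^sub>s i)" by (rule stage_map_continuous[OF above[OF i]])
  fix j z assume j: "j \<in> index_above \<Lambda> prec \<beta>" and ij: "prec i j" and "z \<in> topspace (X\<^sub>s j)"
  then obtain x where x: "x \<in> topspace X" "z = h j x" using topspace_stage[OF above[OF j]] by auto
  then show "p\<^sub>s i (hb i j z) = b i j (p\<^sub>s j z)"
    using hb_eq[OF above[OF i] above[OF j] ij x(1)] stage_map_h[OF above[OF i] x(1)]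
      stage_map_h[OF above[OF j] x(1)]
      projection_bond[OF cover_in_base[OF x(1)] above_index[OF above[OF i]] above_index[OF above[OF j]] ij]
    by simp
qed

text \<open>For surjectivity, let \<open>h i (c i)\<close> be the coordinates of a thread.  The values \<open>fhat n (c i)\<close> do not
depend on \<open>i\<close>, and the points \<open>\<pi> i (p (c i))\<close> form a thread that comes from some \<open>g\<close>.  The lift of
\<open>g\<close> to the slice \<open>V n l\<close> containing \<open>c \<beta>\<close>, where \<open>n\<close> has positive weight at \<open>g\<close>, has the same value
under \<open>fhat n\<close> as every \<open>c i\<close>, and separation then identifies its image under \<open>h i\<close> with \<open>h i (c i)\<close>.\<close>

lemma total_limit:
  assumes sep: "separating \<beta>"
  shows "homeomorphic_map X (limit_topology (index_above \<Lambda> prec \<beta>) prec X\<^sub>s hb)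
           (\<lambda>x. \<lambda>i\<in>index_above \<Lambda> prec \<beta>. h i x)"
proof (rule continuous_imp_homeomorphic_map)
  let ?B = "index_above \<Lambda> prec \<beta>"
  let ?r = "\<lambda>x. \<lambda>i\<in>?B. h i x"
  have \<beta>: "\<beta> \<in> index_above \<Lambda> prec \<alpha>" using sep by (simp add: separating_def)
  note above = above_trans[OF \<beta>]
  have \<beta>B: "\<beta> \<in> ?B"
    using directed above_index[OF \<beta>] unfolding index_above_def directed_index_set_def by blast
  have limB: "homeomorphic_map S (limit_topology ?B prec T b) (\<lambda>g. \<lambda>i\<in>?B. \<pi> i g)"
    using homeomorphic_map_limit_index_above[OF system limit compact_base Hausdorff_stage above_index[OF \<beta>]] .
  have thr: "?r x \<in> threads ?B prec X\<^sub>s hb" if x: "x \<in> topspace X" for x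
    unfolding threads_def using x topspace_stage[OF above] hb_eq[OF above above _ x] by simp
  show "continuous_map X (limit_topology ?B prec X\<^sub>s hb) ?r"
  proof (rule continuous_map_into_limit_topology)
    show "continuous_map X (X\<^sub>s i) (\<lambda>x. ?r x i)" if "i \<in> ?B" for i
      using h_continuous[OF above[OF that]] that by simp
  qed (fact thr)
  show "compact_space X" by (rule compact_total)
  show "Hausdorff_space (limit_topology ?B prec X\<^sub>s hb)"
    using Hausdorff_total_stage[OF above] by (rule Hausdorff_space_limit_topology)
  show "?r ` topspace X = topspace (limit_topology ?B prec X\<^sub>s hb)"
    unfolding topspace_limit_topology
  proof
    show "?r ` topspace X \<subseteq> threads ?B prec X\<^sub>s hb" using thr by blast
    show "threads ?B prec X\<^sub>s hb \<subseteq> ?r ` topspace X"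
    proof
      fix z assume z: "z \<in> threads ?B prec X\<^sub>s hb"
      have "\<exists>x. x \<in> topspace X \<and> z i = h i x" if "i \<in> ?B" for i
        using threadsD(1)[OF z that] topspace_stage[OF above[OF that]] by auto
      then obtain c where c: "\<And>i. i \<in> ?B \<Longrightarrow> c i \<in> topspace X" "\<And>i. i \<in> ?B \<Longrightarrow> z i = h i (c i)"
        by metis
      have c_down: "h i (c j) = h i (c i)" if ij: "i \<in> ?B" "j \<in> ?B" "prec i j" for i j
        using threadsD(2)[OF z ij] c(2)[OF ij(1)] c(2)[OF ij(2)] c(1)[OF ij(2)]
          hb_eq[OF above[OF ij(1)] above[OF ij(2)] ij(3)] by simp
      have c_fhat: "fhat n (c i) = fhat n (c \<beta>)" if "i \<in> ?B" "n \<in> {1..m}" for i n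
      proof -
        have "prec \<beta> i" using that(1) by (simp add: index_above_def)
        then show ?thesis
          using c_down[OF \<beta>B that(1)] h_eq_iff[OF \<beta> c(1)[OF that(1)] c(1)[OF \<beta>B]] that(2) by blast
      qed
      have "(\<lambda>i\<in>?B. \<pi> i (p (c i))) \<in> threads ?B prec T b"
        unfolding threads_def
      proof (intro CollectI conjI ballI impI)
        show "(\<lambda>i\<in>?B. \<pi> i (p (c i))) \<in> (\<Pi>\<^sub>E i\<in>?B. topspace (T i))"
          using projection_in_stage[OF above_index[OF above] cover_in_base[OF c(1)]] by simp
        fix i j assume ij: "i \<in> ?B" "j \<in> ?B" "prec i j"
        have "\<pi> i (p (c j)) = \<pi> i (p (c i))"
          using c_down[OF ij] h_eq_iff[OF above[OF ij(1)] c(1)[OF ij(2)] c(1)[OF ij(1)]] by blast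
        then show "b i j ((\<lambda>i\<in>?B. \<pi> i (p (c i))) j) = (\<lambda>i\<in>?B. \<pi> i (p (c i))) i"
          using projection_bond[OF cover_in_base[OF c(1)[OF ij(2)]] above_index[OF above[OF ij(1)]]
              above_index[OF above[OF ij(2)]] ij(3)] ij by simp
      qed
      then have "(\<lambda>i\<in>?B. \<pi> i (p (c i))) \<in> (\<lambda>g. \<lambda>i\<in>?B. \<pi> i g) ` topspace S"
        using homeomorphic_imp_surjective_map[OF limB] by (simp add: topspace_limit_topology)
      then obtain g where g: "g \<in> topspace S" "(\<lambda>i\<in>?B. \<pi> i (p (c i))) = (\<lambda>i\<in>?B. \<pi> i g)" by blast
      have g_eq: "\<pi> i g = \<pi> i (p (c i))" if "i \<in> ?B" for i
        using fun_cong[OF g(2), of i] that by simp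
      obtain n where n: "n \<in> {1..m}" "weight n g > 0"
        using exists_positive_weight[OF projection_in_stage[OF base_index g(1)]] .
      have w: "weight n g = weight n (p (c i))" if "i \<in> ?B" for i
        using weight_eq_if_projection_eq[OF above[OF that] g(1) cover_in_base[OF c(1)[OF that]] g_eq[OF that]] .
      obtain l where l: "l \<in> {1..k}" "c \<beta> \<in> V n l"
        using slice_of_positive_weight[OF n(1) c(1)[OF \<beta>B]] n(2) w[OF \<beta>B] by metis
      have "g \<in> W n"
        using positive_weight_in_support[OF g(1) n(2)] weight_support[OF n(1)] by blast
      then have "g \<in> p ` V n l" using slice_partitionD(3)[OF slices[OF n(1)] l(1)] by simp
      then obtain x where x: "x \<in> V n l" "p x = g" by blast
      have xX: "x \<in> topspace X" using x slice_subset[OF n(1) l(1)] by blast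
      have "z i = h i x" if i: "i \<in> ?B" for i
      proof -
        have "fhat n x = fhat n (c i)"
          using fhat_slice[OF n(1) l(1) x(1)] fhat_slice[OF n(1) l] x(2) w[OF \<beta>B] c_fhat[OF i n(1)] by simp
        then have "h i x = h i (c i)"
          using sep i xX c(1)[OF i] n x(2) g_eq[OF i] unfolding separating_def by blast
        then show ?thesis using c(2)[OF i] by simp
      qed
      moreover have "z \<in> extensional ?B" using z by (simp add: threads_def PiE_def)
      ultimately have "z = ?r x" by (intro extensionalityI[of z ?B]) auto
      then show "z \<in> ?r ` topspace X" using xX by blast
    qed
  qed
  show "inj_on ?r (topspace X)"
  proof (rule inj_onI)
    fix x x' assume x: "x \<in> topspace X" "x' \<in> topspace X" "?r x = ?r x'"
    have h: "h i x = h i x'" if "i \<in> ?B" for i using fun_cong[OF x(3), of i] that by simp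
    have "\<pi> i (p x) = \<pi> i (p x')" if "i \<in> ?B" for i
      using h[OF that] h_eq_iff[OF above[OF that] x(1,2)] by blast
    then have "(\<lambda>i\<in>?B. \<pi> i (p x)) = (\<lambda>i\<in>?B. \<pi> i (p x'))" by (simp add: restrict_def fun_eq_iff)
    then have px: "p x = p x'"
      using inj_onD[OF homeomorphic_imp_injective_map[OF limB]] cover_in_base x(1,2) by blast
    obtain n where n: "n \<in> {1..m}" "weight n (p x) > 0"
      using exists_positive_weight[OF projection_in_stage[OF base_index cover_in_base[OF x(1)]]] .
    obtain l where l: "l \<in> {1..k}" "x \<in> V n l" using slice_of_positive_weight[OF n(1) x(1) n(2)] .
    have "x' \<in> V n l" using same_slice_if_h_eq[OF \<beta> n(1) l x(2) h[OF \<beta>B] n(2)] .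
    then show "x = x'" using inj_onD[OF slice_partitionD(4)[OF slices[OF n(1)] l(1)] px l(2)] by blast
  qed
qed

lemma cover_is_limit_morphism:
  assumes sep: "separating \<beta>"
  shows "is_limit_morphism_up_to_iso (index_above \<Lambda> prec \<beta>) prec X\<^sub>s hb T b p\<^sub>s X S p"
  unfolding is_limit_morphism_up_to_iso_def
proof (intro exI conjI ballI)
  let ?B = "index_above \<Lambda> prec \<beta>"
  have \<beta>: "\<beta> \<in> index_above \<Lambda> prec \<alpha>" using sep by (simp add: separating_def)
  show "homeomorphic_map X (limit_topology ?B prec X\<^sub>s hb) (\<lambda>x. \<lambda>i\<in>?B. h i x)"
    by (rule total_limit[OF sep])
  show "homeomorphic_map S (limit_topology ?B prec T b) (\<lambda>g. \<lambda>i\<in>?B. \<pi> i g)"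
    using homeomorphic_map_limit_index_above[OF system limit compact_base Hausdorff_stage above_index[OF \<beta>]] .
  show "limit_morphism ?B p\<^sub>s (\<lambda>i\<in>?B. h i x) = (\<lambda>i\<in>?B. \<pi> i (p x))" if "x \<in> topspace X" for x
    using stage_map_h[OF above_trans[OF \<beta>] that] by (auto simp: limit_morphism_def restrict_def)
qed

end


section \<open>The covering of a compact group as a limit of coverings\<close>

theorem mainTheorem5:
  fixes G :: "'g monoid" and TG :: "'g topology"
    and X :: "'x topology" and k :: nat and p :: "'x \<Rightarrow> 'g"
    and \<Lambda> :: "'i set" and prec :: "'i \<Rightarrow> 'i \<Rightarrow> bool"
    and H :: "'i \<Rightarrow> 'h monoid" and TH :: "'i \<Rightarrow> 'h topology"
    and b :: "'i \<Rightarrow> 'i \<Rightarrow> 'h \<Rightarrow> 'h" and \<pi> :: "'i \<Rightarrow> 'g \<Rightarrow> 'h"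
    and \<alpha> :: 'i and m :: nat
    and W :: "nat \<Rightarrow> 'g set" and W\<alpha> :: "nat \<Rightarrow> 'h set" and V :: "nat \<Rightarrow> nat \<Rightarrow> 'x set"
    and U :: "nat \<Rightarrow> 'g set" and U\<alpha> :: "nat \<Rightarrow> 'h set" and \<phi> :: "nat \<Rightarrow> 'h \<Rightarrow> real"
    and f fhat :: "nat \<Rightarrow> 'x \<Rightarrow> complex"
    and h :: "'i \<Rightarrow> 'x \<Rightarrow> 'h \<times> (nat \<Rightarrow> complex)"
    and X\<^sub>s :: "'i \<Rightarrow> ('h \<times> (nat \<Rightarrow> complex)) topology"
    and p\<^sub>s :: "'i \<Rightarrow> 'h \<times> (nat \<Rightarrow> complex) \<Rightarrow> 'h"
    and hb :: "'i \<Rightarrow> 'i \<Rightarrow> 'h \<times> (nat \<Rightarrow> complex) \<Rightarrow> 'h \<times> (nat \<Rightarrow> complex)"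
    \<comment> \<open>the covering\<close>
  assumes "compact_group G TG" and "connected_space TG"
    and "Hausdorff_space X" and "k \<ge> 1" and "k_fold_covering k X TG p"
    \<comment> \<open>the inverse system of Lie groups\<close>
    and "compact_group_system \<Lambda> prec H TH b"
    and "is_compact_group_limit \<Lambda> prec H TH b G TG \<pi>"
    and "\<And>i. i \<in> \<Lambda> \<Longrightarrow> Lie_group (H i) (TH i) \<and> connected_space (TH i)"
    and "\<And>i j. i \<in> \<Lambda> \<Longrightarrow> j \<in> \<Lambda> \<Longrightarrow> prec i j \<Longrightarrow>
           open_map (TH j) (TH i) (b i j) \<and> b i j ` carrier (H j) = carrier (H i)"
    and "\<And>i. i \<in> \<Lambda> \<Longrightarrow> open_map TG (TH i) (\<pi> i) \<and> \<pi> i ` carrier G = carrier (H i)"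
    and "comm_group G \<Longrightarrow> \<forall>i\<in>\<Lambda>. comm_group (H i)"
    \<comment> \<open>covers, slices and the partition of unity\<close>
    and "\<alpha> \<in> \<Lambda>" and "m \<ge> 1"
    and "\<And>n. n \<in> {1..m} \<Longrightarrow> openin TG (W n)" and "(\<Union>n\<in>{1..m}. W n) = carrier G"
    and "\<And>n. n \<in> {1..m} \<Longrightarrow> openin (TH \<alpha>) (W\<alpha> n)" and "(\<Union>n\<in>{1..m}. W\<alpha> n) = carrier (H \<alpha>)"
    and "\<And>n. n \<in> {1..m} \<Longrightarrow> W n = {g \<in> carrier G. \<pi> \<alpha> g \<in> W\<alpha> n}"
    and "\<And>n. n \<in> {1..m} \<Longrightarrow> slice_partition k X TG p (W n) (V n)"
    and "\<And>n. n \<in> {1..m} \<Longrightarrow> openin (TH \<alpha>) (U\<alpha> n)" and "(\<Union>n\<in>{1..m}. U\<alpha> n) = carrier (H \<alpha>)"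
    and "\<And>n. n \<in> {1..m} \<Longrightarrow> U\<alpha> n \<subseteq> W\<alpha> n"
    and "\<And>n. n \<in> {1..m} \<Longrightarrow> U n = {g \<in> carrier G. \<pi> \<alpha> g \<in> U\<alpha> n}"
    and "\<And>n. n \<in> {1..m} \<Longrightarrow> TG closure_of (U n) \<subseteq> W n"
    and "\<And>n. n \<in> {1..m} \<Longrightarrow> continuous_map (TH \<alpha>) (top_of_set {0..1}) (\<phi> n)"
    and "\<And>n. n \<in> {1..m} \<Longrightarrow>
           TH \<alpha> closure_of {y \<in> carrier (H \<alpha>). \<phi> n y \<in> {0<..1}} \<subseteq> U\<alpha> n"
    and "\<And>y. y \<in> carrier (H \<alpha>) \<Longrightarrow> (\<Sum>n=1..m. \<phi> n y) = 1"
    \<comment> \<open>the constructed functions, spaces and mappings\<close>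
    and "\<And>n x. n \<in> {1..m} \<Longrightarrow> x \<in> topspace X \<Longrightarrow> p x \<notin> W n \<Longrightarrow> f n x = 0"
    and "\<And>n l x. n \<in> {1..m} \<Longrightarrow> l \<in> {1..k} \<Longrightarrow> x \<in> V n l \<Longrightarrow>
           f n x = exp (\<i> * complex_of_real (2 * pi / real k * (real l - 1)))"
    and "\<And>n x. n \<in> {1..m} \<Longrightarrow> x \<in> topspace X \<Longrightarrow>
           fhat n x = complex_of_real (\<phi> n (\<pi> \<alpha> (p x))) * f n x"
    and "\<And>i x. i \<in> index_above \<Lambda> prec \<alpha> \<Longrightarrow> x \<in> topspace X \<Longrightarrow>
           h i x = (\<pi> i (p x), \<lambda>n\<in>{1..m}. fhat n x)"
    and "\<And>i. i \<in> index_above \<Lambda> prec \<alpha> \<Longrightarrow>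
           X\<^sub>s i = subtopology
             (prod_topology (TH i) (product_topology (\<lambda>n. euclidean) {1..m})) (h i ` topspace X)"
    and "\<And>i y. i \<in> index_above \<Lambda> prec \<alpha> \<Longrightarrow> y \<in> topspace (X\<^sub>s i) \<Longrightarrow> p\<^sub>s i y = fst y"
    and "\<And>i j x. i \<in> index_above \<Lambda> prec \<alpha> \<Longrightarrow> j \<in> index_above \<Lambda> prec \<alpha> \<Longrightarrow> prec i j \<Longrightarrow>
           x \<in> topspace X \<Longrightarrow> hb i j (h j x) = h i x"
  shows "\<exists>\<beta> \<in> index_above \<Lambda> prec \<alpha>.
    (\<forall>i \<in> index_above \<Lambda> prec \<beta>. k_fold_covering k (X\<^sub>s i) (TH i) (p\<^sub>s i)) \<and>
    compact_space X \<and>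
    (\<forall>i \<in> index_above \<Lambda> prec \<beta>. compact_space (X\<^sub>s i) \<and> Hausdorff_space (X\<^sub>s i) \<and>
       compact_space (TH i) \<and> Hausdorff_space (TH i)) \<and>
    inverse_system (index_above \<Lambda> prec \<beta>) prec X\<^sub>s hb \<and>
    inverse_system (index_above \<Lambda> prec \<beta>) prec TH b \<and>
    system_morphism (index_above \<Lambda> prec \<beta>) prec X\<^sub>s hb TH b p\<^sub>s \<and>
    is_limit_morphism_up_to_iso (index_above \<Lambda> prec \<beta>) prec X\<^sub>s hb TH b p\<^sub>s X TG p"
proof -
  note a = assms
  have carrier_G: "topspace TG = carrier G" and compact_G: "compact_space TG"
    using a(1) by (simp_all add: compact_group_def topological_group_def)
  have groups: "compact_group (H i) (TH i)" if "i \<in> \<Lambda>" for i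
    using a(6) that by (simp add: compact_group_system_def)
  have carrier_H: "topspace (TH i) = carrier (H i)" if "i \<in> \<Lambda>" for i
    using groups[OF that] by (simp add: compact_group_def topological_group_def)
  have system: "inverse_system \<Lambda> prec TH b"
    using a(6) by (simp add: compact_group_system_def)
  have cover: "continuous_map X TG p" "p ` topspace X = topspace TG"
    using a(5) by (simp_all add: k_fold_covering_def)
  have limit: "homeomorphic_map TG (limit_topology \<Lambda> prec TH b) (\<lambda>x. \<lambda>i\<in>\<Lambda>. \<pi> i x)"
    using a(7) by (simp add: is_compact_group_limit_def)
  have \<alpha>: "\<alpha> \<in> \<Lambda>" by fact
  have weight_continuous: "continuous_map (TH \<alpha>) euclideanreal (\<phi> n)" if "n \<in> {1..m}" for n
    using a(25)[OF that] by (rule continuous_map_into_fulltopology)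
  have weight_range: "\<phi> n y \<in> {0..1}" if "n \<in> {1..m}" "y \<in> topspace (TH \<alpha>)" for n y
    using continuous_map_image_subset_topspace[OF a(25)[OF that(1)]] that(2) by auto
  have support: "TG closure_of {g \<in> topspace TG. \<phi> n (\<pi> \<alpha> g) > 0} \<subseteq> W n" if n: "n \<in> {1..m}" for n
  proof -
    have "\<phi> n (\<pi> \<alpha> g) > 0 \<Longrightarrow> g \<in> U n" if g: "g \<in> topspace TG" for g
    proof -
      assume pos: "\<phi> n (\<pi> \<alpha> g) > 0"
      have y: "\<pi> \<alpha> g \<in> topspace (TH \<alpha>)"
        using a(10)[OF \<alpha>] g carrier_G carrier_H[OF \<alpha>] by blast
      then have "\<pi> \<alpha> g \<in> {y \<in> carrier (H \<alpha>). \<phi> n y \<in> {0<..1}}"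
        using weight_range[OF n y] pos carrier_H[OF \<alpha>] by simp
      then have "\<pi> \<alpha> g \<in> U\<alpha> n"
        using a(26)[OF n] closure_of_subset[of "{y \<in> carrier (H \<alpha>). \<phi> n y \<in> {0<..1}}" "TH \<alpha>"]
          carrier_H[OF \<alpha>] by blast
      then show "g \<in> U n" using a(23)[OF n] g carrier_G by simp
    qed
    then have "{g \<in> topspace TG. \<phi> n (\<pi> \<alpha> g) > 0} \<subseteq> U n" by blast
    then show ?thesis using closure_of_mono a(24)[OF n] by (metis order_trans)
  qed
  have slice_X: "x \<in> topspace X" "p x \<in> W n" if "n \<in> {1..m}" "l \<in> {1..k}" "x \<in> V n l" for n l x
    using a(19)[OF that(1)] that(2,3) unfolding slice_partition_def by blast+
  interpret sheet_tower X TG k p \<Lambda> prec TH b \<pi> \<alpha> m W V \<phi> fhat h X\<^sub>s p\<^sub>s hb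
  proof
    show "\<And>i. i \<in> \<Lambda> \<Longrightarrow> Hausdorff_space (TH i)" using groups by (simp add: compact_group_def)
    show "\<And>i. i \<in> \<Lambda> \<Longrightarrow> \<pi> i ` topspace TG = topspace (TH i)"
      using a(10) carrier_G carrier_H by simp
    show "fhat n x = complex_of_real (\<phi> n (\<pi> \<alpha> (p x))) * sheet_label k l"
      if "n \<in> {1..m}" "l \<in> {1..k}" "x \<in> V n l" for n l x
      using a(30)[OF that(1) slice_X(1)[OF that]] a(29)[OF that] by (simp add: sheet_label_def)
    show "fhat n x = 0" if "n \<in> {1..m}" "x \<in> topspace X" "\<phi> n (\<pi> \<alpha> (p x)) = 0" for n x
      using a(30)[OF that(1,2)] that(3) by simp
    show "(\<Sum>n=1..m. \<phi> n y) = 1" if "y \<in> topspace (TH \<alpha>)" for y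
      using a(27) carrier_H[OF \<alpha>] that by simp
  qed (use compact_G cover system limit \<alpha> a(10,19,31,32,33,34) weight_continuous weight_range support
      in \<open>simp_all\<close>)
  obtain \<beta> where sep: "separating \<beta>" using exists_separating by blast
  then have \<beta>: "\<beta> \<in> index_above \<Lambda> prec \<alpha>" by (simp add: separating_def)
  show ?thesis
  proof (intro bexI[OF _ \<beta>] conjI ballI)
    fix i assume i: "i \<in> index_above \<Lambda> prec \<beta>"
    show "k_fold_covering k (X\<^sub>s i) (TH i) (p\<^sub>s i)" using stage_covering[OF sep i] .
    show "compact_space (X\<^sub>s i)" using compact_total_stage[OF above_trans[OF \<beta> i]] .
    show "Hausdorff_space (X\<^sub>s i)" using Hausdorff_total_stage[OF above_trans[OF \<beta> i]] .
    show "compact_space (TH i)" "Hausdorff_space (TH i)"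
      using groups[OF above_index[OF above_trans[OF \<beta> i]]] by (simp_all add: compact_group_def)
  next
    show "compact_space X" by (rule compact_total)
    show "inverse_system (index_above \<Lambda> prec \<beta>) prec X\<^sub>s hb" by (rule total_system[OF \<beta>])
    show "inverse_system (index_above \<Lambda> prec \<beta>) prec TH b"
      using inverse_system_index_above[OF system above_index[OF \<beta>]] .
    show "system_morphism (index_above \<Lambda> prec \<beta>) prec X\<^sub>s hb TH b p\<^sub>s" by (rule stage_morphism[OF \<beta>])
    show "is_limit_morphism_up_to_iso (index_above \<Lambda> prec \<beta>) prec X\<^sub>s hb TH b p\<^sub>s X TG p"
      by (rule cover_is_limit_morphism[OF sep])
  qed
qed

end
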